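(* Consider the unit sphere $S^7\subset\mathbb{R}^8$ with its standard nearly parallel $\mathrm{G}_2$-structure $\varphi=\iota^*(E\lrcorner\Psi)$ inducing the round metric, with the $T^3$-action generated by $U_1=V_0+V_3$, $U_2=V_1+V_3$, $U_3=V_2-V_3$, and with multi-moment map $$\nu=\varphi(U_1,U_2,U_3)=4\operatorname{Im}(z^1z^2z^3z^4),$$ all defined in the context. Then: (a) The image of $\nu$ is $\nu(S^7)=[-1/4,1/4]$. (b) The only non-zero critical values of $\nu$ are the maximum and minimum $\pm1/4$, and the corresponding critical sets are each diffeomorphic to $T^3$. (c) The $T^3$-quotient of the set of critical points in $\nu^{-1}(0)$ forms a trivalent graph with four vertices and six edges, the edges connecting each pair of distinct vertices. (d) Each $s\in(-1/4,0)\cup(0,1/4)$ is a regular value of $\nu$, and $\nu^{-1}(s)/T^3$ is diffeomorphic to a three-sphere.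
   Context: Let $(x^0,\dots,x^7)$ be the standard coordinates on $\mathbb{R}^8$, $\partial_i$ the coordinate vector fields, $\iota\colon S^7\to\mathbb{R}^8$ the inclusion and $E=\sum_{k=0}^7x^k\partial_k$ the Euler vector field. On $\mathbb{R}^7$ with coordinates $x^1,\dots,x^7$ and $e^i=dx^i$ put $\varphi_0=e^{123}-e^1(e^{45}+e^{67})-e^2(e^{46}+e^{75})-e^3(e^{47}+e^{56})$ and ${\star}\varphi_0=e^{4567}-e^{23}(e^{45}+e^{67})-e^{31}(e^{46}+e^{75})-e^{12}(e^{47}+e^{56})$ (with $e^{ijk}=e^i\wedge e^j\wedge e^k$, etc.), and define the four-form $\Psi=dx^0\wedge\varphi_0+{\star}\varphi_0$ on $\mathbb{R}^8$. The three-form $\varphi=\iota^*(E\lrcorner\Psi)$ is a $\mathrm{G}_2$-structure on $S^7$ with induced metric the round one and $d\varphi=4\,{\star\varphi}$. For $i=0,1,2,3$ put $V_i=-x^{2i+1}\partial_{2i}+x^{2i}\partial_{2i+1}$. The commuting vector fields $U_1=V_0+V_3$, $U_2=V_1+V_3$, $U_3=V_2-V_3$ preserve $\Psi$, hence $\varphi$, and generate a three-torus $T^3$ (a maximal torus of $\mathrm{Spin}(7)$) acting on $S^7$. The complex coordinates are $z^1=x^0-ix^1$, $z^2=x^2-ix^3$, $z^3=x^4+ix^5$, $z^4=x^6+ix^7$. *)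

theory Defs
  imports "HOL-Analysis.Analysis"
begin

section \<open>Smooth maps, differentials and diffeomorphisms\<close>

text \<open>Class \<open>C\<^sup>k\<close> on an open set. In finite dimensions a map is of class \<open>C\<^sup>k\<^sup>+\<^sup>1\<close> iff it is
  differentiable and all its directional derivatives are of class \<open>C\<^sup>k\<close>.\<close>

primrec Ck_on :: "nat \<Rightarrow> 'a set \<Rightarrow> ('a::euclidean_space \<Rightarrow> 'b::euclidean_space) \<Rightarrow> bool" where
  "Ck_on 0 U f \<longleftrightarrow> continuous_on U f"
| "Ck_on (Suc k) U f \<longleftrightarrow> (\<forall>x\<in>U. f differentiable (at x)) \<and>
     (\<forall>v. Ck_on k U (\<lambda>x. frechet_derivative f (at x) v))"

text \<open>Only meant for open \<open>U\<close>.\<close>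
definition smooth_on :: "'a set \<Rightarrow> ('a::euclidean_space \<Rightarrow> 'b::euclidean_space) \<Rightarrow> bool" where
  "smooth_on U f \<longleftrightarrow> (\<forall>k. Ck_on k U f)"

text \<open>Smoothness on an arbitrary subset of a Euclidean space: locally the restriction of a smooth
  map on an open set. On embedded submanifolds this is smoothness in the sense of manifolds, and
  a set \<open>diffeomorphic\<close> (as defined below) to an embedded submanifold is itself one.\<close>
definition smooth_map :: "'a set \<Rightarrow> ('a::euclidean_space \<Rightarrow> 'b::euclidean_space) \<Rightarrow> bool" where
  "smooth_map S f \<longleftrightarrow>
     (\<forall>x\<in>S. \<exists>U g. open U \<and> x \<in> U \<and> smooth_on U g \<and> (\<forall>y\<in>S \<inter> U. g y = f y))"

definition diffeomorphic :: "'a::euclidean_space set \<Rightarrow> 'b::euclidean_space set \<Rightarrow> bool" where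
  "diffeomorphic S T \<longleftrightarrow>
     (\<exists>f g. smooth_map S f \<and> smooth_map T g \<and> f ` S = T \<and> g ` T = S \<and>
        (\<forall>x\<in>S. g (f x) = x) \<and> (\<forall>y\<in>T. f (g y) = y))"

definition smooth_curve_through :: "'a::euclidean_space set \<Rightarrow> 'a \<Rightarrow> (real \<Rightarrow> 'a) \<Rightarrow> bool" where
  "smooth_curve_through M p \<gamma> \<longleftrightarrow>
     \<gamma> 0 = p \<and> (\<exists>\<epsilon>>0. smooth_on {-\<epsilon><..<\<epsilon>} \<gamma> \<and> \<gamma> ` {-\<epsilon><..<\<epsilon>} \<subseteq> M)"

text \<open>The image of the tangent space of the submanifold \<open>M\<close> at \<open>p\<close> under the differential of
  \<open>f\<close>; tangent vectors are the velocities at time \<open>0\<close> of smooth curves in \<open>M\<close> through \<open>p\<close>.\<close>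
definition differential_range ::
  "'a::euclidean_space set \<Rightarrow> ('a \<Rightarrow> 'b::euclidean_space) \<Rightarrow> 'a \<Rightarrow> 'b set" where
  "differential_range M f p =
     {w. \<exists>\<gamma>. smooth_curve_through M p \<gamma> \<and> ((f \<circ> \<gamma>) has_vector_derivative w) (at 0)}"

definition critical_points ::
  "'a::euclidean_space set \<Rightarrow> ('a \<Rightarrow> 'b::euclidean_space) \<Rightarrow> 'a set" where
  "critical_points M f = {p \<in> M. differential_range M f p \<noteq> UNIV}"

definition critical_values ::
  "'a::euclidean_space set \<Rightarrow> ('a \<Rightarrow> 'b::euclidean_space) \<Rightarrow> 'b set" where
  "critical_values M f = f ` critical_points M f"

definition regular_value ::
  "'a::euclidean_space set \<Rightarrow> ('a \<Rightarrow> 'b::euclidean_space) \<Rightarrow> 'b \<Rightarrow> bool" where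
  "regular_value M f s \<longleftrightarrow> (\<forall>p\<in>M. f p = s \<longrightarrow> differential_range M f p = UNIV)"


section \<open>Quotients\<close>

definition quotient_topology :: "'a topology \<Rightarrow> ('a \<Rightarrow> 'p) \<Rightarrow> 'p topology" where
  "quotient_topology X q =
     topology (\<lambda>W. W \<subseteq> q ` topspace X \<and> openin X {x \<in> topspace X. q x \<in> W})"

lemma openin_quotient_topology:
  "openin (quotient_topology X q) W \<longleftrightarrow>
     W \<subseteq> q ` topspace X \<and> openin X {x \<in> topspace X. q x \<in> W}"
proof -
  have "istopology (\<lambda>W. W \<subseteq> q ` topspace X \<and> openin X {x \<in> topspace X. q x \<in> W})"
    unfolding istopology_def
  proof (intro conjI allI impI)
    fix S T
    assume S: "S \<subseteq> q ` topspace X \<and> openin X {x \<in> topspace X. q x \<in> S}"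
      and T: "T \<subseteq> q ` topspace X \<and> openin X {x \<in> topspace X. q x \<in> T}"
    show "S \<inter> T \<subseteq> q ` topspace X" using S by blast
    have "{x \<in> topspace X. q x \<in> S \<inter> T} =
        {x \<in> topspace X. q x \<in> S} \<inter> {x \<in> topspace X. q x \<in> T}" by blast
    then show "openin X {x \<in> topspace X. q x \<in> S \<inter> T}" using S T by (simp add: openin_Int)
  next
    fix K
    assume K: "\<forall>S\<in>K. S \<subseteq> q ` topspace X \<and> openin X {x \<in> topspace X. q x \<in> S}"
    show "\<Union>K \<subseteq> q ` topspace X" using K by blast
    have "{x \<in> topspace X. q x \<in> \<Union>K} = (\<Union>S\<in>K. {x \<in> topspace X. q x \<in> S})" by blast
    then show "openin X {x \<in> topspace X. q x \<in> \<Union>K}" using K by (metis (no_types, lifting) openin_Union imageE)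
  qed
  then show ?thesis by (simp add: quotient_topology_def topology_inverse')
qed

lemma quotient_map_quotient_topology: "quotient_map X (quotient_topology X q) q"
proof -
  have "{x \<in> topspace X. q x \<in> q ` topspace X} = topspace X" by blast
  then have "openin (quotient_topology X q) (q ` topspace X)"
    by (simp add: openin_quotient_topology)
  then have "topspace (quotient_topology X q) = q ` topspace X"
    by (metis openin_quotient_topology openin_subset openin_topspace subset_antisym)
  then show ?thesis by (simp add: quotient_map_def openin_quotient_topology)
qed

text \<open>An abstract smooth manifold modelled on \<open>'e\<close>; a chart is a pair of an open domain and a
  coordinate map on it.\<close>
definition smooth_manifold ::
  "'p topology \<Rightarrow> ('p set \<times> ('p \<Rightarrow> 'e::euclidean_space)) set \<Rightarrow> bool" where
  "smooth_manifold X A \<longleftrightarrow>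
     Hausdorff_space X \<and> second_countable X \<and> (\<Union>(U, c)\<in>A. U) = topspace X \<and>
     (\<forall>(U, c)\<in>A. openin X U \<and> open (c ` U) \<and>
        homeomorphic_map (subtopology X U) (top_of_set (c ` U)) c) \<and>
     (\<forall>(U, c)\<in>A. \<forall>(V, d)\<in>A. smooth_on (c ` (U \<inter> V)) (d \<circ> inv_into U c))"

text \<open>The quotient smooth structure on \<open>q ` M\<close>: the one, unique up to equivalence of atlases,
  that makes the projection \<open>q\<close> from the submanifold \<open>M\<close> a smooth submersion.\<close>
definition quotient_manifold ::
  "'a::euclidean_space set \<Rightarrow> ('a \<Rightarrow> 'p) \<Rightarrow> ('p set \<times> ('p \<Rightarrow> 'e::euclidean_space)) set \<Rightarrow> bool" where
  "quotient_manifold M q A \<longleftrightarrow>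
     smooth_manifold (quotient_topology (top_of_set M) q) A \<and>
     (\<forall>(U, c)\<in>A. smooth_map (M \<inter> q -` U) (c \<circ> q) \<and>
        (\<forall>p\<in>M \<inter> q -` U. differential_range M (c \<circ> q) p = UNIV))"

text \<open>Diffeomorphism between an abstract manifold and a submanifold \<open>N\<close> of a Euclidean space.\<close>
definition manifold_diffeomorphic ::
  "'p topology \<Rightarrow> ('p set \<times> ('p \<Rightarrow> 'e::euclidean_space)) set \<Rightarrow> 'b::euclidean_space set \<Rightarrow> bool" where
  "manifold_diffeomorphic X A N \<longleftrightarrow>
     (\<exists>F. homeomorphic_map X (top_of_set N) F \<and>
        (\<forall>(U, c)\<in>A. smooth_map (c ` U) (F \<circ> inv_into U c) \<and>
           smooth_map (F ` U) (c \<circ> inv_into (topspace X) F)))"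


section \<open>Topological graphs\<close>

definition arc_between :: "'p topology \<Rightarrow> 'p set \<Rightarrow> 'p \<Rightarrow> 'p \<Rightarrow> bool" where
  "arc_between X e v w \<longleftrightarrow> e \<subseteq> topspace X \<and>
     (\<exists>g. homeomorphic_map (top_of_set {0..1::real}) (subtopology X e) g \<and> g 0 = v \<and> g 1 = w)"

text \<open>The space \<open>X\<close> is a finite graph (multiple edges allowed, no loops) with vertices \<open>V\<close> and
  closed edges \<open>E\<close>; the end points of an edge \<open>e\<close> are the elements of \<open>e \<inter> V\<close>.\<close>
definition topological_graph :: "'p topology \<Rightarrow> 'p set \<Rightarrow> 'p set set \<Rightarrow> bool" where
  "topological_graph X V E \<longleftrightarrow>
     Hausdorff_space X \<and> finite V \<and> finite E \<and> V \<union> \<Union>E = topspace X \<and>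
     (\<forall>e\<in>E. \<exists>v w. v \<noteq> w \<and> e \<inter> V = {v, w} \<and> arc_between X e v w) \<and>
     (\<forall>e\<in>E. \<forall>f\<in>E. e \<noteq> f \<longrightarrow> e \<inter> f \<subseteq> V)"


section \<open>The four-form, the torus action and the multi-moment map\<close>

text \<open>The coordinates \<open>x\<^sup>0, \<dots>, x\<^sup>7\<close> of \<open>x :: real^8\<close> are \<open>x $ 0, \<dots>, x $ 7\<close>, so \<open>0\<close> is a genuine
  index. Forms with constant coefficients are multilinear functions of tangent vectors, normalised
  by \<open>(dx\<^sup>1 \<and> \<dots> \<and> dx\<^sup>k)(\<partial>\<^sub>1, \<dots>, \<partial>\<^sub>k) = 1\<close>.\<close>

definition dx3 :: "8 \<Rightarrow> 8 \<Rightarrow> 8 \<Rightarrow> real^8 \<Rightarrow> real^8 \<Rightarrow> real^8 \<Rightarrow> real" where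
  "dx3 i j k u v w = det (vector [vector [u $ i, v $ i, w $ i],
                                  vector [u $ j, v $ j, w $ j],
                                  vector [u $ k, v $ k, w $ k]] :: real^3^3)"

definition dx4 :: "8 \<Rightarrow> 8 \<Rightarrow> 8 \<Rightarrow> 8 \<Rightarrow> real^8 \<Rightarrow> real^8 \<Rightarrow> real^8 \<Rightarrow> real^8 \<Rightarrow> real" where
  "dx4 i j k l u v w y = det (vector [vector [u $ i, v $ i, w $ i, y $ i],
                                      vector [u $ j, v $ j, w $ j, y $ j],
                                      vector [u $ k, v $ k, w $ k, y $ k],
                                      vector [u $ l, v $ l, w $ l, y $ l]] :: real^4^4)"

definition phi0 :: "real^8 \<Rightarrow> real^8 \<Rightarrow> real^8 \<Rightarrow> real" where
  "phi0 u v w = dx3 1 2 3 u v w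
     - (dx3 1 4 5 u v w + dx3 1 6 7 u v w)
     - (dx3 2 4 6 u v w + dx3 2 7 5 u v w)
     - (dx3 3 4 7 u v w + dx3 3 5 6 u v w)"

definition star_phi0 :: "real^8 \<Rightarrow> real^8 \<Rightarrow> real^8 \<Rightarrow> real^8 \<Rightarrow> real" where
  "star_phi0 u v w y = dx4 4 5 6 7 u v w y
     - (dx4 2 3 4 5 u v w y + dx4 2 3 6 7 u v w y)
     - (dx4 3 1 4 6 u v w y + dx4 3 1 7 5 u v w y)
     - (dx4 1 2 4 7 u v w y + dx4 1 2 5 6 u v w y)"

text \<open>\<open>\<Psi> = dx\<^sup>0 \<and> \<phi>\<^sub>0 + \<star>\<phi>\<^sub>0\<close>; the alternating sum is the wedge product of a one-form with a
  three-form.\<close>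
definition Psi :: "real^8 \<Rightarrow> real^8 \<Rightarrow> real^8 \<Rightarrow> real^8 \<Rightarrow> real" where
  "Psi u v w y =
     u $ 0 * phi0 v w y - v $ 0 * phi0 u w y + w $ 0 * phi0 u v y - y $ 0 * phi0 u v w
     + star_phi0 u v w y"

definition S7 :: "(real^8) set" where
  "S7 = sphere 0 1"

definition euler :: "real^8 \<Rightarrow> real^8" where
  "euler x = (\<Sum>k\<in>UNIV. x $ k *\<^sub>R axis k 1)"

text \<open>At a point \<open>p\<close> of the sphere the arguments \<open>u\<close>, \<open>v\<close>, \<open>w\<close> are tangent to the sphere.\<close>
definition phi :: "real^8 \<Rightarrow> real^8 \<Rightarrow> real^8 \<Rightarrow> real^8 \<Rightarrow> real" where
  "phi p u v w = Psi (euler p) u v w"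

definition V :: "nat \<Rightarrow> real^8 \<Rightarrow> real^8" where
  "V i x = - x $ of_nat (2 * i + 1) *\<^sub>R axis (of_nat (2 * i)) 1
           + x $ of_nat (2 * i) *\<^sub>R axis (of_nat (2 * i + 1)) 1"

definition U1 :: "real^8 \<Rightarrow> real^8" where "U1 x = V 0 x + V 3 x"
definition U2 :: "real^8 \<Rightarrow> real^8" where "U2 x = V 1 x + V 3 x"
definition U3 :: "real^8 \<Rightarrow> real^8" where "U3 x = V 2 x - V 3 x"

definition nu :: "real^8 \<Rightarrow> real" where
  "nu x = phi x (U1 x) (U2 x) (U3 x)"

text \<open>As the fields commute, the group they generate consists of the time-one flows of their
  constant linear combinations.\<close>
definition T3_orbit :: "real^8 \<Rightarrow> (real^8) set" where
  "T3_orbit x = {\<gamma> 1 |\<gamma> a b c. \<gamma> 0 = x \<and>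
     (\<forall>t. (\<gamma> has_vector_derivative
             (a *\<^sub>R U1 (\<gamma> t) + b *\<^sub>R U2 (\<gamma> t) + c *\<^sub>R U3 (\<gamma> t))) (at t))}"

text \<open>The quotient \<open>S/T\<^sup>3\<close> of an invariant set \<open>S\<close>.\<close>
abbreviation orbit_space :: "(real^8) set \<Rightarrow> (real^8) set topology" where
  "orbit_space S \<equiv> quotient_topology (top_of_set S) T3_orbit"

definition level_set :: "real \<Rightarrow> (real^8) set" where
  "level_set s = {x \<in> S7. nu x = s}"

definition T3 :: "(complex^3) set" where
  "T3 = {z. \<forall>i. cmod (z $ i) = 1}"

definition z1 :: "real^8 \<Rightarrow> complex" where "z1 x = of_real (x $ 0) - \<i> * of_real (x $ 1)"
definition z2 :: "real^8 \<Rightarrow> complex" where "z2 x = of_real (x $ 2) - \<i> * of_real (x $ 3)"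
definition z3 :: "real^8 \<Rightarrow> complex" where "z3 x = of_real (x $ 4) + \<i> * of_real (x $ 5)"

text \<open>The sign in \<open>z4\<close> is forced by \<open>\<Psi>\<close>, \<open>U1\<close>, \<open>U2\<close> and \<open>U3\<close>: with
  \<open>x\<^sup>6 - \<i>x\<^sup>7\<close> instead, \<open>Im (z1 z2 z3 z4)\<close> would not be invariant under the torus and would not
  be a multiple of \<open>nu\<close>.\<close>
definition z4 :: "real^8 \<Rightarrow> complex" where "z4 x = of_real (x $ 6) + \<i> * of_real (x $ 7)"

end

theory Submission
  imports Defs
begin

text \<open>The orbit of a point is determined by the four moduli \<open>|z\<^sub>j|\<close> and by the product
  \<open>P = z\<^sub>1z\<^sub>2z\<^sub>3z\<^sub>4\<close>, and \<open>\<nu> = 4 Im P\<close>. On the sphere the gradient of \<open>\<nu>\<close> is radial iff every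
  product of three coordinates equals \<open>\<i> \<nu>\<close> times the conjugate of the fourth; hence either all moduli
  agree and \<open>P = \<plusminus>\<i>/16\<close>, or two coordinates vanish. In the second case the moduli identify the
  quotient with the edges of a tetrahedron.

  For \<open>0 < |\<sigma>| < 1/16\<close> the quotient of \<open>Im P = \<sigma>\<close> is the set of \<open>(r, h)\<close> with \<open>r\<^sub>j > 0\<close>, \<open>\<Sum>r\<^sub>j = 1\<close>
  and \<open>r\<^sub>1r\<^sub>2r\<^sub>3r\<^sub>4 = h\<^sup>2 + \<sigma>\<^sup>2\<close>. With \<open>A = (r\<^sub>1 - r\<^sub>2) / 2\<surd>(r\<^sub>1r\<^sub>2)\<close>, \<open>B = (r\<^sub>3 - r\<^sub>4) / 2\<surd>(r\<^sub>3r\<^sub>4)\<close>,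
  \<open>D = h/\<sigma>\<close> and \<open>E\<close> defined by \<open>1 + E\<^sup>2 = (4(r\<^sub>1 + r\<^sub>2)(r\<^sub>3 + r\<^sub>4))\<^sup>-\<^sup>2\<close>, the sign being that of
  \<open>r\<^sub>1 + r\<^sub>2 - r\<^sub>3 - r\<^sub>4\<close>, this becomes
  \<open>(1 + A\<^sup>2)(1 + B\<^sup>2)(1 + E\<^sup>2)(1 + D\<^sup>2) = 1/(256\<sigma>\<^sup>2)\<close>, and a triangular change of coordinates turns
  that hypersurface into a round sphere. Both directions are explicit and a global section exists, so
  no implicit function theorem is needed. All maps are built from polynomials, inverses and square
  roots, whose derivatives are again of this kind; this gives their smoothness.\<close>

section \<open>Coordinates\<close>

lemma exhaust_8:
  fixes x :: 8
  shows "x = 0 \<or> x = 1 \<or> x = 2 \<or> x = 3 \<or> x = 4 \<or> x = 5 \<or> x = 6 \<or> x = 7"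
proof (induct x)
  case (of_int z)
  then have "0 \<le> z" "z < 8" by simp_all
  then have "z = 0 \<or> z = 1 \<or> z = 2 \<or> z = 3 \<or> z = 4 \<or> z = 5 \<or> z = 6 \<or> z = 7" by arith
  then show ?case by auto
qed

lemma UNIV_8: "(UNIV :: 8 set) = {0, 1, 2, 3, 4, 5, 6, 7}"
  using exhaust_8 by auto

lemma forall_8:
  "(\<forall>i::8. P i) \<longleftrightarrow> P 0 \<and> P 1 \<and> P 2 \<and> P 3 \<and> P 4 \<and> P 5 \<and> P 6 \<and> P 7"
  by (metis exhaust_8)

lemma sum_8:
  "sum f (UNIV :: 8 set) = f 0 + f 1 + f 2 + f 3 + f 4 + f 5 + f 6 + f 7"
  unfolding UNIV_8 by (simp add: ac_simps)

lemma vec8_eq_iff: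
  fixes x y :: "'a ^ 8"
  shows "x = y \<longleftrightarrow> x $ 0 = y $ 0 \<and> x $ 1 = y $ 1 \<and> x $ 2 = y $ 2 \<and> x $ 3 = y $ 3 \<and>
    x $ 4 = y $ 4 \<and> x $ 5 = y $ 5 \<and> x $ 6 = y $ 6 \<and> x $ 7 = y $ 7"
  by (simp add: vec_eq_iff forall_8)

lemma vector_4:
  "(vector [a, b, c, d] :: 'a::zero ^ 4) $ 1 = a"
  "(vector [a, b, c, d] :: 'a ^ 4) $ 2 = b"
  "(vector [a, b, c, d] :: 'a ^ 4) $ 3 = c"
  "(vector [a, b, c, d] :: 'a ^ 4) $ 4 = d"
  by (simp_all add: vector_def)

text \<open>Permutations of the index set are peeled off one element at a time, which yields the
  cofactor expansion along the first row and makes \<open>dx4\<close> computable.\<close>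

lemma det_4:
  fixes A :: "'a::comm_ring_1 ^ 4 ^ 4"
  shows "det A =
    A$1$1 * (A$2$2 * (A$3$3 * A$4$4 - A$3$4 * A$4$3) - A$2$3 * (A$3$2 * A$4$4 - A$3$4 * A$4$2)
      + A$2$4 * (A$3$2 * A$4$3 - A$3$3 * A$4$2))
    - A$1$2 * (A$2$1 * (A$3$3 * A$4$4 - A$3$4 * A$4$3) - A$2$3 * (A$3$1 * A$4$4 - A$3$4 * A$4$1)
      + A$2$4 * (A$3$1 * A$4$3 - A$3$3 * A$4$1))
    + A$1$3 * (A$2$1 * (A$3$2 * A$4$4 - A$3$4 * A$4$2) - A$2$2 * (A$3$1 * A$4$4 - A$3$4 * A$4$1)
      + A$2$4 * (A$3$1 * A$4$2 - A$3$2 * A$4$1))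
    - A$1$4 * (A$2$1 * (A$3$2 * A$4$3 - A$3$3 * A$4$2) - A$2$2 * (A$3$1 * A$4$3 - A$3$3 * A$4$1)
      + A$2$3 * (A$3$1 * A$4$2 - A$3$2 * A$4$1))"
proof -
  have f1234: "finite {2::4, 3, 4}" "1 \<notin> {2::4, 3, 4}"
    and f234: "finite {3::4, 4}" "2 \<notin> {3::4, 4}"
    and f34: "finite {4::4}" "3 \<notin> {4::4}"
    by auto
  show ?thesis
    unfolding det_def UNIV_4
    unfolding sum_over_permutations_insert[OF f1234]
    unfolding sum_over_permutations_insert[OF f234]
    unfolding sum_over_permutations_insert[OF f34]
    unfolding permutes_sing
    by (simp add: sign_swap_id permutation_swap_id permutation_compose sign_compose sign_id
        swap_id_eq algebra_simps)
qed

lemma euler_eq: "euler x = x"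
  by (simp add: euler_def vec8_eq_iff sum_8 axis_def)

lemma U_nth:
  "U1 x $ 0 = - x $ 1" "U1 x $ 1 = x $ 0" "U1 x $ 2 = 0" "U1 x $ 3 = 0"
  "U1 x $ 4 = 0" "U1 x $ 5 = 0" "U1 x $ 6 = - x $ 7" "U1 x $ 7 = x $ 6"
  "U2 x $ 0 = 0" "U2 x $ 1 = 0" "U2 x $ 2 = - x $ 3" "U2 x $ 3 = x $ 2"
  "U2 x $ 4 = 0" "U2 x $ 5 = 0" "U2 x $ 6 = - x $ 7" "U2 x $ 7 = x $ 6"
  "U3 x $ 0 = 0" "U3 x $ 1 = 0" "U3 x $ 2 = 0" "U3 x $ 3 = 0"
  "U3 x $ 4 = - x $ 5" "U3 x $ 5 = x $ 4" "U3 x $ 6 = x $ 7" "U3 x $ 7 = - x $ 6"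
  by (simp_all add: U1_def U2_def U3_def V_def axis_def)

text \<open>Once the determinants are expanded, both sides are polynomials in the eight coordinates,
  and \<open>algebra\<close> compares them.\<close>

lemma nu_eq: "nu x = 4 * Im (z1 x * z2 x * z3 x * z4 x)"
  by (simp add: nu_def phi_def Psi_def phi0_def star_phi0_def dx3_def dx4_def det_3 det_4
      vector_4 euler_eq U_nth z1_def z2_def z3_def z4_def) algebra

text \<open>The signs at the indices 1 and 3 match the conventions of \<open>z1\<close> and
  \<open>z2\<close>; the final \<open>else\<close> is the index 7.\<close>

definition of_z :: "complex \<Rightarrow> complex \<Rightarrow> complex \<Rightarrow> complex \<Rightarrow> real^8" where
  "of_z a b c d = (\<chi> i. if i = 0 then Re a else if i = 1 then - Im a
     else if i = 2 then Re b else if i = 3 then - Im b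
     else if i = 4 then Re c else if i = 5 then Im c
     else if i = 6 then Re d else Im d)"

lemma of_z_nth:
  "of_z a b c d $ 0 = Re a" "of_z a b c d $ 1 = - Im a"
  "of_z a b c d $ 2 = Re b" "of_z a b c d $ 3 = - Im b"
  "of_z a b c d $ 4 = Re c" "of_z a b c d $ 5 = Im c"
  "of_z a b c d $ 6 = Re d" "of_z a b c d $ 7 = Im d"
  by (simp_all add: of_z_def)

lemma z_of_z [simp]:
  "z1 (of_z a b c d) = a" "z2 (of_z a b c d) = b" "z3 (of_z a b c d) = c" "z4 (of_z a b c d) = d"
  by (simp_all add: z1_def z2_def z3_def z4_def of_z_nth complex_eq_iff)

lemma z_eqI:
  assumes "z1 x = z1 y" "z2 x = z2 y" "z3 x = z3 y" "z4 x = z4 y"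
  shows "x = y"
  using assms by (simp add: z1_def z2_def z3_def z4_def complex_eq_iff vec8_eq_iff)

text \<open>The whole complex product is kept: its imaginary part is \<open>nu / 4\<close>, and its
  real part is a further torus invariant that serves as a coordinate on the quotients.\<close>

definition z_prod :: "real^8 \<Rightarrow> complex" where
  "z_prod x = z1 x * z2 x * z3 x * z4 x"

lemma nu_eq_z_prod: "nu x = 4 * Im (z_prod x)"
  by (simp add: nu_eq z_prod_def)

lemma inner_eq_z: "x \<bullet> y = Re (cnj (z1 x) * z1 y) + Re (cnj (z2 x) * z2 y)
    + Re (cnj (z3 x) * z3 y) + Re (cnj (z4 x) * z4 y)"
  by (simp add: inner_vec_def sum_8 z1_def z2_def z3_def z4_def)

lemma S7_iff: "x \<in> S7 \<longleftrightarrow>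
    (cmod (z1 x))\<^sup>2 + (cmod (z2 x))\<^sup>2 + (cmod (z3 x))\<^sup>2 + (cmod (z4 x))\<^sup>2 = 1"
proof -
  have "x \<in> S7 \<longleftrightarrow> x \<bullet> x = 1"
    by (simp add: S7_def norm_eq_1)
  then show ?thesis
    unfolding inner_eq_z cmod_power2 by (simp add: power2_eq_square)
qed

section \<open>A class of smooth functions\<close>

text \<open>An inductive class allows closure under composition and differentiation to be shown by
  rule induction. Positivity under roots avoids the point where \<open>sqrt\<close> is not
  differentiable.\<close>

inductive elementary_on :: "'a::euclidean_space set \<Rightarrow> ('a \<Rightarrow> real) \<Rightarrow> bool" for U where
  const: "elementary_on U (\<lambda>x. c)"
| inner: "elementary_on U (\<lambda>x. x \<bullet> b)"
| add: "elementary_on U f \<Longrightarrow> elementary_on U g \<Longrightarrow> elementary_on U (\<lambda>x. f x + g x)"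
| mult: "elementary_on U f \<Longrightarrow> elementary_on U g \<Longrightarrow> elementary_on U (\<lambda>x. f x * g x)"
| inverse: "elementary_on U f \<Longrightarrow> (\<And>x. x \<in> U \<Longrightarrow> f x \<noteq> 0) \<Longrightarrow> elementary_on U (\<lambda>x. inverse (f x))"
| sqrt: "elementary_on U f \<Longrightarrow> (\<And>x. x \<in> U \<Longrightarrow> f x > 0) \<Longrightarrow> elementary_on U (\<lambda>x. sqrt (f x))"

lemma elementary_on_minus:
  assumes "elementary_on U f"
  shows "elementary_on U (\<lambda>x. - f x)"
  using elementary_on.mult[OF elementary_on.const[of U "-1"] assms] by simp

lemma elementary_on_diff:
  assumes "elementary_on U f" "elementary_on U g"
  shows "elementary_on U (\<lambda>x. f x - g x)"
  using elementary_on.add[OF assms(1) elementary_on_minus[OF assms(2)]] by simp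

lemma elementary_on_divide:
  assumes "elementary_on U f" "elementary_on U g" "\<And>x. x \<in> U \<Longrightarrow> g x \<noteq> 0"
  shows "elementary_on U (\<lambda>x. f x / g x)"
  using elementary_on.mult[OF assms(1) elementary_on.inverse[OF assms(2,3)]]
  by (simp add: divide_inverse)

lemma elementary_on_power:
  assumes "elementary_on U f"
  shows "elementary_on U (\<lambda>x. f x ^ n)"
  by (induction n) (auto intro: elementary_on.const elementary_on.mult assms)

lemma elementary_on_vec_nth: "elementary_on U (\<lambda>x :: real ^ 'n. x $ i)"
  using elementary_on.inner[of U "axis i 1"] by (simp add: inner_axis)

lemma elementary_on_id: "elementary_on U (\<lambda>t :: real. t)"
  using elementary_on.inner[of U "1 :: real"] by simp

lemmas elementary_on_intros = elementary_on.const elementary_on.add elementary_on.mult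
  elementary_on_minus elementary_on_diff elementary_on_divide elementary_on_power
  elementary_on.sqrt elementary_on_vec_nth elementary_on_id

lemma elementary_on_sum:
  assumes "\<And>i. i \<in> I \<Longrightarrow> elementary_on U (f i)"
  shows "elementary_on U (\<lambda>x. \<Sum>i\<in>I. f i x)"
  using assms
  by (induction I rule: infinite_finite_induct) (auto intro: elementary_on.const elementary_on.add)

text \<open>Induction on the outer function. Only its linear case meets the components of
  \<open>g\<close>, through the expansion in the basis; \<open>sub\<close> carries the side
  conditions of inverses and roots over to \<open>U\<close>.\<close>

lemma elementary_on_compose:
  assumes "elementary_on T f" and g: "\<And>b. b \<in> Basis \<Longrightarrow> elementary_on U (\<lambda>x. g x \<bullet> b)"
    and sub: "\<And>x. x \<in> U \<Longrightarrow> g x \<in> T"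
  shows "elementary_on U (\<lambda>x. f (g x))"
  using assms(1)
proof induction
  case (inner b)
  have "(\<lambda>x. g x \<bullet> b) = (\<lambda>x. \<Sum>i\<in>Basis. (g x \<bullet> i) * (b \<bullet> i))"
    by (simp add: euclidean_inner[of _ b])
  then show ?case
    by (simp only:) (intro elementary_on_sum elementary_on.mult g elementary_on.const)
next
  case (inverse f)
  then show ?case using sub by (intro elementary_on.inverse) auto
next
  case (sqrt f)
  then show ?case using sub by (intro elementary_on.sqrt) auto
qed (intro elementary_on.const elementary_on.add elementary_on.mult; assumption)+

lemma elementary_on_subset:
  assumes "elementary_on U f" "T \<subseteq> U"
  shows "elementary_on T f"
  using elementary_on_compose[OF assms(1), of T "\<lambda>x. x"] assms(2)
  by (auto intro: elementary_on.inner)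

text \<open>In each fixed direction the derivative stays in the class, so differentiation can be
  repeated indefinitely.\<close>

lemma elementary_on_has_derivative:
  assumes "elementary_on U f"
  shows "\<exists>f'. (\<forall>x\<in>U. (f has_derivative f' x) (at x)) \<and> (\<forall>v. elementary_on U (\<lambda>x. f' x v))"
  using assms
proof induction
  case (const c)
  show ?case
    by (rule exI[of _ "\<lambda>x v. 0"]) (auto intro: elementary_on.const)
next
  case (inner b)
  show ?case
    by (rule exI[of _ "\<lambda>x v. v \<bullet> b"])
      (auto intro: elementary_on.const intro!: derivative_eq_intros)
next
  case (add f g)
  then obtain f' g' where "\<And>x. x \<in> U \<Longrightarrow> (f has_derivative f' x) (at x)"
      "\<And>v. elementary_on U (\<lambda>x. f' x v)" "\<And>x. x \<in> U \<Longrightarrow> (g has_derivative g' x) (at x)"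
      "\<And>v. elementary_on U (\<lambda>x. g' x v)" by metis
  then show ?case
    by (intro exI[of _ "\<lambda>x v. f' x v + g' x v"])
      (auto intro!: elementary_on.add has_derivative_add)
next
  case (mult f g)
  then obtain f' g' where "\<And>x. x \<in> U \<Longrightarrow> (f has_derivative f' x) (at x)"
      "\<And>v. elementary_on U (\<lambda>x. f' x v)" "\<And>x. x \<in> U \<Longrightarrow> (g has_derivative g' x) (at x)"
      "\<And>v. elementary_on U (\<lambda>x. g' x v)" by metis
  with mult.hyps show ?case
    by (intro exI[of _ "\<lambda>x v. f x * g' x v + f' x v * g x"])
      (auto intro!: elementary_on.add elementary_on.mult has_derivative_mult)
next
  case (inverse f)
  then obtain f' where "\<And>x. x \<in> U \<Longrightarrow> (f has_derivative f' x) (at x)"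
      "\<And>v. elementary_on U (\<lambda>x. f' x v)" by metis
  with inverse.hyps show ?case
    by (intro exI[of _ "\<lambda>x v. - (inverse (f x) * f' x v * inverse (f x))"])
      (auto intro!: elementary_on_minus elementary_on.mult elementary_on.inverse
        has_derivative_inverse)
next
  case (sqrt f)
  then obtain f' where f': "\<forall>x\<in>U. (f has_derivative f' x) (at x)"
      "\<forall>v. elementary_on U (\<lambda>x. f' x v)"
    by (elim exE conjE)
  \<comment> \<open>The derivative is phrased with \<open>inverse\<close> instead of a quotient so
    that the closure rules for products and inverses match it.\<close>
  have "((\<lambda>x. sqrt (f x)) has_derivative (\<lambda>v. f' x v * (inverse (sqrt (f x)) * inverse 2))) (at x)"
    if "x \<in> U" for x
    using has_derivative_real_sqrt[OF sqrt.hyps(2)[OF that] bspec[OF f'(1) that]]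
    by (simp only: divide_inverse mult_1_left)
  moreover have "sqrt (f x) \<noteq> 0" if "x \<in> U" for x
    using sqrt.hyps(2)[OF that] by simp
  then have "elementary_on U (\<lambda>x. inverse (sqrt (f x)))"
    by (intro elementary_on.inverse elementary_on.sqrt sqrt.hyps)
  ultimately show ?case
    by (intro exI[of _ "\<lambda>x v. f' x v * (inverse (sqrt (f x)) * inverse 2)"] conjI ballI allI
        elementary_on.mult elementary_on.const f'(2)[rule_format])
qed

section \<open>From the elementary class to smooth maps\<close>

lemma has_derivative_cong_open:
  assumes "open U" "x \<in> U" "\<And>y. y \<in> U \<Longrightarrow> f y = g y"
  shows "(f has_derivative f') (at x) \<longleftrightarrow> (g has_derivative f') (at x)"
  by (metis assms has_derivative_transform_within_open)

text \<open>The derivatives in \<open>Ck_on\<close> are those of the ambient space; as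
  \<open>U\<close> is open, the values on \<open>U\<close> determine them at points of
  \<open>U\<close>.\<close>

lemma Ck_on_cong:
  assumes "open U" "\<And>x. x \<in> U \<Longrightarrow> f x = g x" "Ck_on k U f"
  shows "Ck_on k U g"
  using assms(2,3)
proof (induction k arbitrary: f g)
  case 0
  then show ?case using continuous_on_cong by (metis Ck_on.simps(1))
next
  case (Suc k)
  have D: "(f has_derivative f') (at x) \<longleftrightarrow> (g has_derivative f') (at x)" if "x \<in> U" for x f'
    using has_derivative_cong_open[OF assms(1) that] Suc.prems(1) by blast
  have "g differentiable (at x)" if "x \<in> U" for x
    using Suc.prems(2) D[OF that] that unfolding differentiable_def Ck_on.simps by blast
  moreover have "Ck_on k U (\<lambda>x. frechet_derivative g (at x) v)" for v
  proof (rule Suc.IH)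
    show "Ck_on k U (\<lambda>x. frechet_derivative f (at x) v)"
      using Suc.prems(2) by simp
    show "frechet_derivative f (at x) v = frechet_derivative g (at x) v" if "x \<in> U" for x
      using D[OF that] by (simp add: frechet_derivative_def)
  qed
  ultimately show ?case by simp
qed

text \<open>Induction on the order for arbitrary \<open>f\<close>: the derivative assembled from the
  componentwise ones satisfies the same hypothesis. It is known to equal
  \<open>frechet_derivative\<close> on \<open>U\<close> only, whence
  \<open>Ck_on_cong\<close>.\<close>

lemma Ck_on_elementary:
  fixes f :: "'a::euclidean_space \<Rightarrow> 'b::euclidean_space"
  assumes "open U" "\<And>b. b \<in> Basis \<Longrightarrow> elementary_on U (\<lambda>x. f x \<bullet> b)"
  shows "Ck_on k U f"
  using assms(2)
proof (induction k arbitrary: f)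
  case (0 f)
  have "continuous_on U (\<lambda>x. f x \<bullet> b)" if b: "b \<in> Basis" for b
  proof -
    obtain f' where f': "\<forall>x\<in>U. ((\<lambda>x. f x \<bullet> b) has_derivative f' x) (at x)"
      using elementary_on_has_derivative[OF 0[OF b]] by (elim exE conjE)
    show ?thesis
      by (intro continuous_at_imp_continuous_on ballI has_derivative_continuous[OF bspec[OF f']])
  qed
  then show ?case
    using continuous_on_componentwise[of U f] by simp
next
  case (Suc k f)
  have "\<forall>b\<in>Basis. \<exists>f'. (\<forall>x\<in>U. ((\<lambda>x. f x \<bullet> b) has_derivative f' x) (at x)) \<and>
      (\<forall>v. elementary_on U (\<lambda>x. f' x v))"
    by (intro ballI elementary_on_has_derivative Suc.prems)
  then obtain d where "\<forall>b\<in>Basis. (\<forall>x\<in>U. ((\<lambda>x. f x \<bullet> b) has_derivative d b x) (at x)) \<and>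
      (\<forall>v. elementary_on U (\<lambda>x. d b x v))"
    by (rule bchoice[THEN exE])
  then have d: "\<And>b x. b \<in> Basis \<Longrightarrow> x \<in> U \<Longrightarrow> ((\<lambda>x. f x \<bullet> b) has_derivative d b x) (at x)"
      "\<And>b v. b \<in> Basis \<Longrightarrow> elementary_on U (\<lambda>x. d b x v)"
    by auto
  define f' where "f' x v = (\<Sum>b\<in>Basis. d b x v *\<^sub>R b)" for x v
  have f'_b: "f' x v \<bullet> b = d b x v" if "b \<in> Basis" for x v b
    using that by (simp add: f'_def inner_sum_left inner_Basis if_distrib cong: if_cong)
  have D: "(f has_derivative f' x) (at x)" if "x \<in> U" for x
    unfolding has_derivative_componentwise_within[of f]
    using d(1) that f'_b by simp
  have eq: "f' x v = frechet_derivative f (at x) v" if "x \<in> U" for x v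
    using frechet_derivative_at[OF D[OF that]] by simp
  have "Ck_on k U (\<lambda>x. frechet_derivative f (at x) v)" for v
  proof (rule Ck_on_cong[OF assms(1) eq])
    show "Ck_on k U (\<lambda>x. f' x v)"
      by (rule Suc.IH) (simp add: f'_b d(2))
  qed
  then show ?case using D by (auto simp: differentiable_def)
qed

lemma smooth_on_elementary:
  assumes "open U" "\<And>b. b \<in> Basis \<Longrightarrow> elementary_on U (\<lambda>x. f x \<bullet> b)"
  shows "smooth_on U f"
  using Ck_on_elementary[OF assms] by (simp add: smooth_on_def)

lemma smooth_on_elementary_vec:
  fixes f :: "'a::euclidean_space \<Rightarrow> real ^ 'n"
  assumes "open U" "\<And>i. elementary_on U (\<lambda>x. f x $ i)"
  shows "smooth_on U f"
  by (rule smooth_on_elementary) (auto simp: Basis_vec_def inner_axis assms)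

lemma smooth_map_open:
  assumes "open U" "S \<subseteq> U" "smooth_on U g" "\<And>y. y \<in> S \<Longrightarrow> g y = f y"
  shows "smooth_map S f"
  unfolding smooth_map_def using assms by (intro ballI exI[of _ U] exI[of _ g]) auto

lemma elementary_on_compose_vec:
  fixes g :: "'a::euclidean_space \<Rightarrow> real ^ 'n"
  assumes "elementary_on T f" "\<And>i. elementary_on U (\<lambda>x. g x $ i)" "\<And>x. x \<in> U \<Longrightarrow> g x \<in> T"
  shows "elementary_on U (\<lambda>x. f (g x))"
  by (rule elementary_on_compose[OF assms(1)]) (auto simp: Basis_vec_def inner_axis assms)

lemma elementary_on_imp_continuous_on:
  assumes "elementary_on U f"
  shows "continuous_on U f"
  using assms
  by (induction) (auto intro!: continuous_intros simp: less_imp_neq)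

definition celementary_on :: "'a::euclidean_space set \<Rightarrow> ('a \<Rightarrow> complex) \<Rightarrow> bool" where
  "celementary_on U f \<longleftrightarrow> elementary_on U (\<lambda>x. Re (f x)) \<and> elementary_on U (\<lambda>x. Im (f x))"

lemma celementary_on_mult:
  "celementary_on U f \<Longrightarrow> celementary_on U g \<Longrightarrow> celementary_on U (\<lambda>x. f x * g x)"
  by (auto simp: celementary_on_def intro!: elementary_on_intros)

lemma celementary_on_const: "celementary_on U (\<lambda>x. c)"
  by (auto simp: celementary_on_def intro!: elementary_on_intros)

lemma celementary_on_cnj: "celementary_on U f \<Longrightarrow> celementary_on U (\<lambda>x. cnj (f x))"
  by (auto simp: celementary_on_def intro!: elementary_on_intros)

lemma celementary_on_z:
  "celementary_on U z1" "celementary_on U z2" "celementary_on U z3" "celementary_on U z4"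
  by (auto simp: celementary_on_def z1_def z2_def z3_def z4_def intro!: elementary_on_intros)

lemma elementary_on_of_z:
  assumes "celementary_on U a" "celementary_on U b" "celementary_on U c" "celementary_on U d"
  shows "elementary_on U (\<lambda>x. of_z (a x) (b x) (c x) (d x) $ i)"
  using assms exhaust_8[of i]
  by (auto simp: celementary_on_def of_z_nth elementary_on_minus)

lemmas celementary_on_intros =
  celementary_on_mult celementary_on_const celementary_on_cnj celementary_on_z

section \<open>Torus orbits\<close>

lemma bounded_linear_z: "bounded_linear z1" "bounded_linear z2" "bounded_linear z3" "bounded_linear z4"
  unfolding linear_conv_bounded_linear[symmetric]
  by (rule linearI; simp add: z1_def z2_def z3_def z4_def complex_eq_iff)+

lemma has_vector_derivative_vec_nth_iff:
  fixes f :: "real \<Rightarrow> real ^ 'n"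
  shows "(f has_vector_derivative D) (at x within S) \<longleftrightarrow>
    (\<forall>i. ((\<lambda>t. f t $ i) has_vector_derivative D $ i) (at x within S))"
  unfolding has_vector_derivative_def has_derivative_componentwise_within[of f]
  by (auto simp: Basis_vec_def inner_axis)

text \<open>Undoing the rotation gives \<open>cis (- (k * t)) * w t\<close>, whose derivative is
  zero; its constant value is compared at the times 0 and 1.\<close>

lemma rotation_ode_unique:
  fixes w :: "real \<Rightarrow> complex"
  assumes "\<And>t. (w has_vector_derivative (\<i> * of_real k * w t)) (at t)"
  shows "w 1 = cis k * w 0"
proof -
  have "((\<lambda>t. cis (- (k * t)) * w t) has_vector_derivative 0) (at t)" for t
  proof -
    have "((\<lambda>t. cis (- (k * t))) has_vector_derivative (- (\<i> * of_real k * cis (- (k * t))))) (at t)"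
      by (auto simp: has_vector_derivative_complex_iff intro!: derivative_eq_intros)
    from has_vector_derivative_mult[OF this assms]
    show ?thesis by (simp add: algebra_simps)
  qed
  then obtain c where "\<And>t. cis (- (k * t)) * w t = c"
    using has_vector_derivative_zero_constant[of UNIV "\<lambda>t. cis (- (k * t)) * w t"] by auto
  from this[of 0] this[of 1] have "cis (- k) * w 1 = w 0" by simp
  then have "cis k * w 0 = (cis k * cis (- k)) * w 1" by (simp only: mult.assoc)
  then show ?thesis by (simp add: cis_mult)
qed

text \<open>The fields are diagonal in the complex coordinates. The four weights of each field sum
  to zero, which is why the torus preserves the product of the coordinates.\<close>

lemma z_U:
  "z1 (U1 x) = - \<i> * z1 x" "z2 (U1 x) = 0" "z3 (U1 x) = 0" "z4 (U1 x) = \<i> * z4 x"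
  "z1 (U2 x) = 0" "z2 (U2 x) = - \<i> * z2 x" "z3 (U2 x) = 0" "z4 (U2 x) = \<i> * z4 x"
  "z1 (U3 x) = 0" "z2 (U3 x) = 0" "z3 (U3 x) = \<i> * z3 x" "z4 (U3 x) = - \<i> * z4 x"
  by (simp_all add: z1_def z2_def z3_def z4_def U_nth complex_eq_iff)

lemma z_linear:
  "z1 (x + y) = z1 x + z1 y" "z2 (x + y) = z2 x + z2 y"
  "z3 (x + y) = z3 x + z3 y" "z4 (x + y) = z4 x + z4 y"
  "z1 (a *\<^sub>R x) = of_real a * z1 x" "z2 (a *\<^sub>R x) = of_real a * z2 x"
  "z3 (a *\<^sub>R x) = of_real a * z3 x" "z4 (a *\<^sub>R x) = of_real a * z4 x"
  by (simp_all add: z1_def z2_def z3_def z4_def complex_eq_iff algebra_simps)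

text \<open>In complex coordinates the flow equation decouples into four scalar rotations, each with
  a unique solution; conversely, the explicit rotating curve is a flow line.\<close>

lemma T3_orbit_iff:
  "y \<in> T3_orbit x \<longleftrightarrow> (\<exists>a b c. z1 y = cis (- a) * z1 x \<and> z2 y = cis (- b) * z2 x \<and>
     z3 y = cis c * z3 x \<and> z4 y = cis (a + b - c) * z4 x)"
proof
  assume "y \<in> T3_orbit x"
  then obtain \<gamma> a b c where y: "y = \<gamma> 1" and x: "\<gamma> 0 = x"
    and D: "\<And>t. (\<gamma> has_vector_derivative
             (a *\<^sub>R U1 (\<gamma> t) + b *\<^sub>R U2 (\<gamma> t) + c *\<^sub>R U3 (\<gamma> t))) (at t)"
    unfolding T3_orbit_def by blast
  have "((\<lambda>t. z1 (\<gamma> t)) has_vector_derivative (\<i> * of_real (- a) * z1 (\<gamma> t))) (at t)"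
    "((\<lambda>t. z2 (\<gamma> t)) has_vector_derivative (\<i> * of_real (- b) * z2 (\<gamma> t))) (at t)"
    "((\<lambda>t. z3 (\<gamma> t)) has_vector_derivative (\<i> * of_real c * z3 (\<gamma> t))) (at t)"
    "((\<lambda>t. z4 (\<gamma> t)) has_vector_derivative (\<i> * of_real (a + b - c) * z4 (\<gamma> t))) (at t)" for t
    using bounded_linear_z[THEN bounded_linear.has_vector_derivative, OF D[of t]]
    by (simp_all add: z_linear z_U algebra_simps)
  then have "z1 y = cis (- a) * z1 x \<and> z2 y = cis (- b) * z2 x \<and>
     z3 y = cis c * z3 x \<and> z4 y = cis (a + b - c) * z4 x"
    unfolding y x[symmetric] by (intro conjI rotation_ode_unique)
  then show "\<exists>a b c. z1 y = cis (- a) * z1 x \<and> z2 y = cis (- b) * z2 x \<and>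
     z3 y = cis c * z3 x \<and> z4 y = cis (a + b - c) * z4 x" by blast
next
  assume "\<exists>a b c. z1 y = cis (- a) * z1 x \<and> z2 y = cis (- b) * z2 x \<and>
     z3 y = cis c * z3 x \<and> z4 y = cis (a + b - c) * z4 x"
  then obtain a b c where y: "z1 y = cis (- a) * z1 x" "z2 y = cis (- b) * z2 x"
     "z3 y = cis c * z3 x" "z4 y = cis (a + b - c) * z4 x" by blast
  define \<gamma> where "\<gamma> t = of_z (cis (- a * t) * z1 x) (cis (- b * t) * z2 x)
    (cis (c * t) * z3 x) (cis ((a + b - c) * t) * z4 x)" for t
  have "y = \<gamma> 1" by (rule z_eqI) (simp_all add: \<gamma>_def y)
  moreover have "\<gamma> 0 = x" by (rule z_eqI) (simp_all add: \<gamma>_def)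
  moreover have "(\<gamma> has_vector_derivative
             (a *\<^sub>R U1 (\<gamma> t) + b *\<^sub>R U2 (\<gamma> t) + c *\<^sub>R U3 (\<gamma> t))) (at t)" for t
    unfolding has_vector_derivative_vec_nth_iff forall_8
      has_real_derivative_iff_has_vector_derivative[symmetric] \<gamma>_def
    by (auto simp: of_z_nth U_nth algebra_simps intro!: derivative_eq_intros)
  ultimately show "y \<in> T3_orbit x" unfolding T3_orbit_def by blast
qed

lemma z_prod_T3_orbit:
  assumes "y \<in> T3_orbit x"
  shows "z_prod y = z_prod x"
proof -
  obtain a b c where y: "z1 y = cis (- a) * z1 x" "z2 y = cis (- b) * z2 x"
     "z3 y = cis c * z3 x" "z4 y = cis (a + b - c) * z4 x" using assms T3_orbit_iff by blast
  have "z_prod y = cis (- a) * cis (- b) * cis c * cis (a + b - c) * z_prod x"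
    by (simp add: z_prod_def y mult_ac)
  also have "cis (- a) * cis (- b) * cis c * cis (a + b - c) = 1"
    by (simp add: cis_mult)
  finally show ?thesis by simp
qed

lemma cmod_T3_orbit:
  assumes "y \<in> T3_orbit x"
  shows "cmod (z1 y) = cmod (z1 x)" "cmod (z2 y) = cmod (z2 x)"
    "cmod (z3 y) = cmod (z3 x)" "cmod (z4 y) = cmod (z4 x)"
  using assms unfolding T3_orbit_iff by (auto simp: norm_mult)

lemma cmod_eq_imp_cis:
  assumes "cmod w = cmod z"
  obtains a where "w = cis a * z"
proof (cases "z = 0")
  case True
  with assms that show ?thesis by simp
next
  case False
  then have "cmod (w / z) = 1" using assms by (simp add: norm_divide)
  then have "w / z = cis (Arg (w / z))"
    by (metis cis_Arg norm_zero sgn_div_norm inverse_1 scaleR_one zero_neq_one)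
  then have "w = cis (Arg (w / z)) * z" using False by (simp add: field_simps)
  with that show ?thesis by blast
qed

text \<open>Equal moduli give four phases, whereas the torus offers only phases of sum zero. If no
  coordinate vanishes, equality of the products makes the total phase trivial; otherwise the phase
  of a vanishing coordinate is free and absorbs the excess.\<close>

lemma T3_orbitI:
  assumes "cmod (z1 y) = cmod (z1 x)" "cmod (z2 y) = cmod (z2 x)"
    "cmod (z3 y) = cmod (z3 x)" "cmod (z4 y) = cmod (z4 x)" and P: "z_prod y = z_prod x"
  shows "y \<in> T3_orbit x"
proof -
  obtain a b c d where y: "z1 y = cis a * z1 x" "z2 y = cis b * z2 x" "z3 y = cis c * z3 x"
      "z4 y = cis d * z4 x"
    by (metis assms(1-4) cmod_eq_imp_cis)
  have *: "y \<in> T3_orbit x" if "z1 y = cis a' * z1 x" "z2 y = cis b' * z2 x" "z3 y = cis c' * z3 x"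
      "z4 y = cis (- a' - b' - c') * z4 x" for a' b' c'
    unfolding T3_orbit_iff using that
    by (intro exI[of _ "- a'"] exI[of _ "- b'"] exI[of _ c']) (simp add: algebra_simps)
  consider "z_prod x \<noteq> 0" | "z1 x = 0" | "z2 x = 0" | "z3 x = 0" | "z4 x = 0"
    by (auto simp: z_prod_def)
  then show ?thesis
  proof cases
    case 1
    have "z_prod y = cis (a + b + c + d) * z_prod x"
      by (simp add: z_prod_def y cis_mult[symmetric] mult_ac)
    then have one: "cis (a + b + c + d) = 1" using P 1 by simp
    have "cis d = cis (a + b + c + d) * cis (- a - b - c)" by (simp add: cis_mult)
    then have "cis d = cis (- a - b - c)" using one by simp
    with y show ?thesis by (intro *[of a b c]) simp_all
  next
    case 2
    with y show ?thesis by (intro *[of "- b - c - d" b c]) simp_all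
  next
    case 3
    with y show ?thesis by (intro *[of a "- a - c - d" c]) simp_all
  next
    case 4
    with y show ?thesis by (intro *[of a b "- a - b - d"]) simp_all
  next
    case 5
    with y show ?thesis by (intro *[of a b c]) simp_all
  qed
qed

lemma mem_T3_orbit_iff:
  "y \<in> T3_orbit x \<longleftrightarrow> cmod (z1 y) = cmod (z1 x) \<and> cmod (z2 y) = cmod (z2 x) \<and>
    cmod (z3 y) = cmod (z3 x) \<and> cmod (z4 y) = cmod (z4 x) \<and> z_prod y = z_prod x"
  using T3_orbitI cmod_T3_orbit z_prod_T3_orbit by metis

lemma T3_orbit_eq_iff:
  "T3_orbit x = T3_orbit y \<longleftrightarrow> cmod (z1 x) = cmod (z1 y) \<and> cmod (z2 x) = cmod (z2 y) \<and>
    cmod (z3 x) = cmod (z3 y) \<and> cmod (z4 x) = cmod (z4 y) \<and> z_prod x = z_prod y"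
proof
  assume "T3_orbit x = T3_orbit y"
  moreover have "x \<in> T3_orbit x" by (simp add: mem_T3_orbit_iff)
  ultimately show "cmod (z1 x) = cmod (z1 y) \<and> cmod (z2 x) = cmod (z2 y) \<and>
    cmod (z3 x) = cmod (z3 y) \<and> cmod (z4 x) = cmod (z4 y) \<and> z_prod x = z_prod y"
    by (simp add: mem_T3_orbit_iff)
qed (auto simp: mem_T3_orbit_iff)

section \<open>Critical points\<close>

definition dnu :: "real^8 \<Rightarrow> real^8 \<Rightarrow> real" where
  "dnu p v = 4 * Im (z2 p * z3 p * z4 p * z1 v + z1 p * z3 p * z4 p * z2 v
     + z1 p * z2 p * z4 p * z3 v + z1 p * z2 p * z3 p * z4 v)"

lemma has_derivative_nu: "(nu has_derivative dnu p) (at p)"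
proof -
  note [derivative_intros] = bounded_linear_z[THEN bounded_linear.has_derivative]
  have "((\<lambda>x. 4 * Im (z1 x * z2 x * z3 x * z4 x)) has_derivative dnu p) (at p)"
    unfolding dnu_def[abs_def] by (auto intro!: derivative_eq_intros simp: algebra_simps)
  then show ?thesis by (simp add: nu_eq[abs_def])
qed

lemma nu_compose_has_vector_derivative:
  assumes "(\<gamma> has_vector_derivative u) (at t)"
  shows "((nu \<circ> \<gamma>) has_vector_derivative dnu (\<gamma> t) u) (at t)"
  using vector_derivative_diff_chain_within[of \<gamma> u t UNIV nu "dnu (\<gamma> t)"] assms
  by (simp add: has_derivative_at_withinI[OF has_derivative_nu])

lemma dnu_scaleR: "dnu p (a *\<^sub>R v) = a * dnu p v"
  by (simp add: dnu_def z_linear algebra_simps)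

lemma dnu_add: "dnu p (v + w) = dnu p v + dnu p w"
  by (simp add: dnu_def z_linear algebra_simps)

text \<open>Euler's identity for a homogeneous polynomial of degree four; it later fixes the
  Lagrange multiplier.\<close>

lemma dnu_self: "dnu p p = 4 * nu p"
  by (simp add: dnu_def nu_eq algebra_simps)

lemma smooth_on_has_vector_derivative:
  assumes "smooth_on U \<gamma>" "t \<in> U"
  obtains u where "(\<gamma> has_vector_derivative u) (at t)"
proof -
  have "Ck_on (Suc 0) U \<gamma>" using assms(1) unfolding smooth_on_def by blast
  then have "\<gamma> differentiable (at t)" using assms(2) by simp
  then show ?thesis using that vector_derivative_works by blast
qed

text \<open>A curve on the sphere has velocity orthogonal to its position, so by the chain rule only
  values of \<open>dnu\<close> at tangent vectors occur.\<close>

lemma differential_range_nu_subset: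
  assumes tangent: "\<And>v. p \<bullet> v = 0 \<Longrightarrow> dnu p v = 0"
  shows "differential_range S7 nu p \<subseteq> {0}"
proof
  fix w assume "w \<in> differential_range S7 nu p"
  then obtain \<gamma> \<epsilon> where \<gamma>: "\<gamma> 0 = p" "\<epsilon> > 0" "smooth_on {-\<epsilon><..<\<epsilon>} \<gamma>" "\<gamma> ` {-\<epsilon><..<\<epsilon>} \<subseteq> S7"
    and w: "((nu \<circ> \<gamma>) has_vector_derivative w) (at 0)"
    unfolding differential_range_def smooth_curve_through_def by blast
  obtain u where u: "(\<gamma> has_vector_derivative u) (at 0)"
    using smooth_on_has_vector_derivative[OF \<gamma>(3), of 0] \<gamma>(2) by auto
  \<comment> \<open>The derivative of the squared norm is computed in two ways: by the product rule,
    and as that of the constant 1 near 0.\<close>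
  have "((\<lambda>t. \<gamma> t \<bullet> \<gamma> t) has_vector_derivative (p \<bullet> u + u \<bullet> p)) (at 0)"
    using u unfolding has_vector_derivative_def
    by (auto intro!: derivative_eq_intros simp: \<gamma>(1) inner_commute algebra_simps)
  moreover have "((\<lambda>t. \<gamma> t \<bullet> \<gamma> t) has_vector_derivative 0) (at 0)"
  proof (rule has_vector_derivative_transform_within_open)
    show "((\<lambda>t. 1 :: real) has_vector_derivative 0) (at (0 :: real))" by simp
    show "1 = \<gamma> t \<bullet> \<gamma> t" if "t \<in> {-\<epsilon><..<\<epsilon>}" for t
    proof -
      have "\<gamma> t \<in> S7" using \<gamma>(4) that by blast
      then show ?thesis by (simp add: S7_def norm_eq_1)
    qed
  qed (use \<gamma>(2) in auto)
  ultimately have "p \<bullet> u + u \<bullet> p = 0" by (rule vector_derivative_unique_at)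
  then have "p \<bullet> u = 0" by (simp add: inner_commute)
  have "((nu \<circ> \<gamma>) has_vector_derivative dnu p u) (at 0)"
    using nu_compose_has_vector_derivative[OF u] by (simp add: \<gamma>(1))
  with w have "w = dnu p u" by (rule vector_derivative_unique_at)
  then show "w \<in> {0}" using tangent[OF \<open>p \<bullet> u = 0\<close>] by simp
qed

text \<open>One tangent vector with non-zero derivative suffices: rescaled, it produces any
  prescribed \<open>w\<close>, and radial projection of a straight line gives a curve on the sphere
  with that velocity.\<close>

lemma differential_range_nu_UNIV:
  assumes p: "p \<in> S7" and v: "p \<bullet> v = 0" "dnu p v \<noteq> 0"
  shows "differential_range S7 nu p = UNIV"
proof -
  have "w \<in> differential_range S7 nu p" for w
  proof -
    define u where "u = (w / dnu p v) *\<^sub>R v"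
    \<comment> \<open>As \<open>u\<close> is orthogonal to the unit vector \<open>p\<close>, the
      point \<open>p + t *\<^sub>R u\<close> has squared norm
      \<open>1 + t\<^sup>2 * (u \<bullet> u)\<close>; the normalising factor \<open>s\<close> has
      derivative zero at 0.\<close>
    define s where "s t = inverse (sqrt (1 + t\<^sup>2 * (u \<bullet> u)))" for t :: real
    define \<gamma> where "\<gamma> t = s t *\<^sub>R (p + t *\<^sub>R u)" for t
    have pu: "p \<bullet> u = 0" and dw: "dnu p u = w"
      using v by (simp_all add: u_def dnu_scaleR)
    have pp: "p \<bullet> p = 1" using p by (simp add: S7_def norm_eq_1)
    have pos: "1 + t\<^sup>2 * (u \<bullet> u) > 0" for t
      by (simp add: add_pos_nonneg)
    have "\<gamma> t \<in> S7" for t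
    proof -
      have "(p + t *\<^sub>R u) \<bullet> (p + t *\<^sub>R u) = 1 + t\<^sup>2 * (u \<bullet> u)"
        using pp pu by (simp add: inner_add_left inner_add_right inner_commute[of u p]
            power2_eq_square)
      then have "\<gamma> t \<bullet> \<gamma> t = (s t)\<^sup>2 * (1 + t\<^sup>2 * (u \<bullet> u))"
        by (simp add: \<gamma>_def power2_eq_square)
      also have "\<dots> = 1" using pos[of t] by (simp add: s_def power_inverse)
      finally show ?thesis by (simp add: S7_def norm_eq_1)
    qed
    moreover have "elementary_on UNIV s"
      unfolding s_def[abs_def]
      using pos by (intro elementary_on.inverse elementary_on_intros) (auto simp: less_imp_neq[THEN not_sym])
    then have "smooth_on {-1<..<1} \<gamma>"
      unfolding \<gamma>_def[abs_def]
      by (intro smooth_on_elementary_vec open_greaterThanLessThan)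
        (auto intro!: elementary_on_intros elementary_on_subset[of UNIV s])
    moreover have "\<gamma> 0 = p" by (simp add: \<gamma>_def s_def)
    moreover have "(\<gamma> has_vector_derivative u) (at 0)"
      unfolding \<gamma>_def s_def by (auto intro!: derivative_eq_intros)
    then have "((nu \<circ> \<gamma>) has_vector_derivative w) (at 0)"
      using nu_compose_has_vector_derivative[of \<gamma> u 0] by (simp add: \<open>\<gamma> 0 = p\<close> dw)
    ultimately show ?thesis
      unfolding differential_range_def smooth_curve_through_def
      by (intro CollectI exI[of _ \<gamma>] conjI exI[of _ 1]) auto
  qed
  then show ?thesis by blast
qed

lemma critical_points_nu:
  "critical_points S7 nu = {p \<in> S7. \<forall>v. p \<bullet> v = 0 \<longrightarrow> dnu p v = 0}"
proof -
  have "UNIV \<noteq> {0 :: real}" and "\<not> (UNIV :: real set) \<subseteq> {0}" by (auto intro: exI[of _ 1])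
  then show ?thesis
    using differential_range_nu_subset differential_range_nu_UNIV
    unfolding critical_points_def by blast
qed

text \<open>These are the Lagrange equations in complex form: \<open>dnu p\<close> is a multiple of
  the inner product with \<open>p\<close>, and Euler's identity shows that the factor is
  \<open>4 * nu p\<close>.\<close>

lemma critical_points_iff:
  "p \<in> critical_points S7 nu \<longleftrightarrow> p \<in> S7 \<and>
     z2 p * z3 p * z4 p = \<i> * nu p * cnj (z1 p) \<and> z1 p * z3 p * z4 p = \<i> * nu p * cnj (z2 p) \<and>
     z1 p * z2 p * z4 p = \<i> * nu p * cnj (z3 p) \<and> z1 p * z2 p * z3 p = \<i> * nu p * cnj (z4 p)"
    (is "_ \<longleftrightarrow> _ \<and> ?grad")
proof -
  have "(\<forall>v. p \<bullet> v = 0 \<longrightarrow> dnu p v = 0) \<longleftrightarrow> ?grad" if p: "p \<in> S7"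
  proof
    assume *: "\<forall>v. p \<bullet> v = 0 \<longrightarrow> dnu p v = 0"
    have D: "dnu p v = 4 * nu p * (p \<bullet> v)" for v
    proof -
      \<comment> \<open>Removing the radial component of \<open>v\<close> makes it tangent to the
        sphere.\<close>
      have "p \<bullet> (v + (- (p \<bullet> v)) *\<^sub>R p) = 0"
        using p by (simp add: inner_diff_right inner_add_right S7_def norm_eq_1)
      then have "dnu p (v + (- (p \<bullet> v)) *\<^sub>R p) = 0" using * by blast
      then have "dnu p v + (- (p \<bullet> v)) * dnu p p = 0"
        by (simp only: dnu_add dnu_scaleR)
      then show ?thesis by (simp add: dnu_self)
    qed
    show ?grad
      \<comment> \<open>The eight real basis directions give the real and imaginary parts of the
        four complex equations.\<close>
      using D[of "of_z 1 0 0 0"] D[of "of_z \<i> 0 0 0"] D[of "of_z 0 1 0 0"] D[of "of_z 0 \<i> 0 0"]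
        D[of "of_z 0 0 1 0"] D[of "of_z 0 0 \<i> 0"] D[of "of_z 0 0 0 1"] D[of "of_z 0 0 0 \<i>"]
      unfolding dnu_def inner_eq_z z_of_z by (simp add: complex_eq_iff)
  next
    assume grad: ?grad
    show "\<forall>v. p \<bullet> v = 0 \<longrightarrow> dnu p v = 0"
    proof (intro allI impI)
      fix v assume "p \<bullet> v = 0"
      have "dnu p v = 4 * nu p * (p \<bullet> v)"
        unfolding dnu_def inner_eq_z grad[THEN conjunct1]
          grad[THEN conjunct2, THEN conjunct1] grad[THEN conjunct2, THEN conjunct2, THEN conjunct1]
          grad[THEN conjunct2, THEN conjunct2, THEN conjunct2]
        by (simp add: algebra_simps)
      then show "dnu p v = 0" using \<open>p \<bullet> v = 0\<close> by simp
    qed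
  qed
  then show ?thesis by (auto simp: critical_points_nu)
qed

section \<open>Solving the critical equations at non-zero values\<close>

text \<open>Each critical equation is multiplied by the coordinate missing from its left-hand side;
  one number is thereby expressed through each of the four moduli.\<close>

lemma z_prod_critical:
  assumes "p \<in> critical_points S7 nu"
  shows "z_prod p = \<i> * of_real (nu p * (cmod (z1 p))\<^sup>2)"
    "z_prod p = \<i> * of_real (nu p * (cmod (z2 p))\<^sup>2)"
    "z_prod p = \<i> * of_real (nu p * (cmod (z3 p))\<^sup>2)"
    "z_prod p = \<i> * of_real (nu p * (cmod (z4 p))\<^sup>2)"
proof -
  note grad = assms[unfolded critical_points_iff]
  have norm_sq: "complex_of_real (cmod z) ^ 2 = z * cnj z" for z
    by (simp add: complex_norm_square[symmetric])
  have *: "z_prod p = \<i> * of_real (nu p * (cmod z)\<^sup>2)"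
    if "z_prod p = z * u" "u = \<i> * nu p * cnj z" for z u
    unfolding that by (simp add: norm_sq mult_ac)
  show "z_prod p = \<i> * of_real (nu p * (cmod (z1 p))\<^sup>2)"
    by (rule *[of _ "z2 p * z3 p * z4 p"], simp add: z_prod_def mult_ac, use grad in blast)
  show "z_prod p = \<i> * of_real (nu p * (cmod (z2 p))\<^sup>2)"
    by (rule *[of _ "z1 p * z3 p * z4 p"], simp add: z_prod_def mult_ac, use grad in blast)
  show "z_prod p = \<i> * of_real (nu p * (cmod (z3 p))\<^sup>2)"
    by (rule *[of _ "z1 p * z2 p * z4 p"], simp add: z_prod_def mult_ac, use grad in blast)
  show "z_prod p = \<i> * of_real (nu p * (cmod (z4 p))\<^sup>2)"
    by (rule *[of _ "z1 p * z2 p * z3 p"], simp add: z_prod_def mult_ac, use grad in blast)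
qed

text \<open>For non-zero \<open>nu p\<close> the four expressions for \<open>z_prod p\<close> force
  equal moduli, hence \<open>1/2\<close> each on the sphere. The norm of \<open>z_prod p\<close>,
  computed directly and from the critical equation, then fixes
  \<open>\<bar>nu p\<bar>\<close>.\<close>

lemma critical_nonzero:
  assumes p: "p \<in> critical_points S7 nu" and "nu p \<noteq> 0"
  shows "cmod (z1 p) = 1/2" "cmod (z2 p) = 1/2" "cmod (z3 p) = 1/2" "cmod (z4 p) = 1/2"
    "z_prod p = \<i> * of_real (nu p / 4)" "\<bar>nu p\<bar> = 1/4"
proof -
  note P = z_prod_critical[OF p]
  have "(cmod (z2 p))\<^sup>2 = (cmod (z1 p))\<^sup>2" "(cmod (z3 p))\<^sup>2 = (cmod (z1 p))\<^sup>2"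
    "(cmod (z4 p))\<^sup>2 = (cmod (z1 p))\<^sup>2"
    using P assms(2) by (simp_all flip: of_real_power)
  moreover have "p \<in> S7" using p by (simp add: critical_points_iff)
  ultimately have r: "(cmod (z1 p))\<^sup>2 = (1/2)\<^sup>2" "(cmod (z2 p))\<^sup>2 = (1/2)\<^sup>2"
    "(cmod (z3 p))\<^sup>2 = (1/2)\<^sup>2" "(cmod (z4 p))\<^sup>2 = (1/2)\<^sup>2"
    unfolding S7_iff by (simp_all add: power_divide)
  then show c: "cmod (z1 p) = 1/2" "cmod (z2 p) = 1/2" "cmod (z3 p) = 1/2" "cmod (z4 p) = 1/2"
    by (simp_all only: power2_eq_iff_nonneg norm_ge_zero zero_le_divide_1_iff zero_le_numeral)
  show Pq: "z_prod p = \<i> * of_real (nu p / 4)"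
    using P(1) r(1) by (simp add: power_divide)
  have "cmod (z_prod p) = \<bar>nu p\<bar> / 4" unfolding Pq by (simp add: norm_mult norm_divide)
  moreover have "cmod (z_prod p) = 1/16" by (simp add: z_prod_def norm_mult c)
  ultimately show "\<bar>nu p\<bar> = 1/4" by simp
qed

lemma critical_level_iff:
  assumes "\<bar>s\<bar> = 1/4"
  shows "p \<in> critical_points S7 nu \<inter> level_set s \<longleftrightarrow>
    cmod (z1 p) = 1/2 \<and> cmod (z2 p) = 1/2 \<and> cmod (z3 p) = 1/2 \<and> cmod (z4 p) = 1/2 \<and>
    z_prod p = \<i> * of_real (s / 4)"
proof
  assume p: "p \<in> critical_points S7 nu \<inter> level_set s"
  then have "nu p = s" by (simp add: level_set_def)
  moreover have "s \<noteq> 0" using assms by auto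
  ultimately show "cmod (z1 p) = 1/2 \<and> cmod (z2 p) = 1/2 \<and> cmod (z3 p) = 1/2 \<and>
      cmod (z4 p) = 1/2 \<and> z_prod p = \<i> * of_real (s / 4)"
    using p critical_nonzero[of p] by auto
next
  assume p: "cmod (z1 p) = 1/2 \<and> cmod (z2 p) = 1/2 \<and> cmod (z3 p) = 1/2 \<and>
      cmod (z4 p) = 1/2 \<and> z_prod p = \<i> * of_real (s / 4)"
  then have c: "cmod (z1 p) = 1/2" "cmod (z2 p) = 1/2" "cmod (z3 p) = 1/2" "cmod (z4 p) = 1/2"
    and P: "z_prod p = \<i> * of_real (s / 4)" by blast+
  have nu: "nu p = s" unfolding nu_eq_z_prod P by simp
  have S7: "p \<in> S7" by (simp add: S7_iff c power_divide)
  \<comment> \<open>Here \<open>u\<close> is the product of the three other coordinates; its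
    critical equation is recovered by cancelling the non-zero \<open>z\<close>.\<close>
  have *: "u = \<i> * of_real s * cnj z" if "z * u = z_prod p" "cmod z = 1/2" for u z
  proof -
    have "z * (\<i> * of_real s * cnj z) = \<i> * of_real s * of_real ((cmod z)\<^sup>2)"
      unfolding complex_norm_square by (simp add: mult_ac)
    also have "\<dots> = z_prod p" unfolding P that(2) by (simp add: power_divide)
    finally have "z * u = z * (\<i> * of_real s * cnj z)" using that(1) by simp
    moreover have "z \<noteq> 0" using that(2) by auto
    ultimately show ?thesis by simp
  qed
  have "p \<in> critical_points S7 nu"
    unfolding critical_points_iff nu
    by (intro conjI S7 *) (simp_all add: c z_prod_def mult_ac)
  then show "p \<in> critical_points S7 nu \<inter> level_set s"
    using S7 nu by (simp add: level_set_def)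
qed

section \<open>The range and the critical values of \<open>nu\<close>\<close>

text \<open>The arithmetic-geometric mean inequality is applied to two pairs of squared moduli and
  then to the two pair sums, which add up to 1.\<close>

lemma nu_bound:
  assumes "x \<in> S7"
  shows "\<bar>nu x\<bar> \<le> 1/4"
proof -
  define a b c d where "a = (cmod (z1 x))\<^sup>2" "b = (cmod (z2 x))\<^sup>2"
    "c = (cmod (z3 x))\<^sup>2" "d = (cmod (z4 x))\<^sup>2"
  have pos: "a \<ge> 0" "b \<ge> 0" "c \<ge> 0" "d \<ge> 0" and s: "a + b + c + d = 1"
    using assms by (simp_all add: a_b_c_d_def S7_iff)
  have amgm: "y * z \<le> ((y + z) / 2)\<^sup>2" for y z :: real
    using zero_le_power2[of "y - z"] by (simp add: power2_eq_square field_simps)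
  have "(cmod (z_prod x))\<^sup>2 = (a * b) * (c * d)"
    by (simp add: z_prod_def a_b_c_d_def norm_mult power_mult_distrib)
  also have "\<dots> \<le> ((a + b) / 2)\<^sup>2 * ((c + d) / 2)\<^sup>2"
    using pos by (intro mult_mono amgm) simp_all
  also have "\<dots> = (((a + b) * (c + d)) / 4)\<^sup>2" by (simp add: power2_eq_square)
  also have "\<dots> \<le> (((a + b + (c + d)) / 2)\<^sup>2 / 4)\<^sup>2"
    using pos amgm[of "a + b" "c + d"] by (intro power_mono divide_right_mono) simp_all
  also have "\<dots> = (1 / 16)\<^sup>2" using s by (simp add: power2_eq_square add.assoc)
  finally have "cmod (z_prod x) \<le> 1/16" by (rule power2_le_imp_le) simp
  then show ?thesis using abs_Im_le_cmod[of "z_prod x"] by (simp add: nu_eq_z_prod)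
qed

lemma nu_image: "nu ` S7 = {-1/4..1/4}"
proof
  show "nu ` S7 \<subseteq> {-1/4..1/4}" using nu_bound by (fastforce simp: abs_if split: if_splits)
  show "{-1/4..1/4} \<subseteq> nu ` S7"
  proof
    fix s :: real assume "s \<in> {-1/4..1/4}"
    then have "\<bar>4 * s\<bar> \<le> 1" by auto
    then have s: "(4 * s)\<^sup>2 \<le> 1" by (simp only: abs_square_le_1)
    \<comment> \<open>All four coordinates have modulus \<open>1/2\<close>, so the point lies on the
      sphere; the imaginary part \<open>2 * s\<close> of the last one is multiplied by
      \<open>4 * (1/8)\<close> in \<open>nu\<close>.\<close>
    define x where "x = of_z (1/2) (1/2) (1/2) (Complex (sqrt (1 - (4 * s)\<^sup>2) / 2) (2 * s))"
    have "x \<in> S7" using s by (simp add: S7_iff x_def cmod_power2 power_divide power_mult_distrib norm_divide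
        diff_divide_distrib)
    moreover have "nu x = s" by (simp add: nu_eq x_def)
    ultimately show "s \<in> nu ` S7" by blast
  qed
qed

lemma critical_level_nonempty:
  assumes "\<bar>s\<bar> = 1/4"
  shows "of_z (1/2) (1/2) (1/2) (\<i> * of_real (2 * s)) \<in> critical_points S7 nu \<inter> level_set s"
  using assms unfolding critical_level_iff[OF assms]
  by (simp add: z_prod_def norm_mult norm_divide)

lemma critical_values_nu: "critical_values S7 nu - {0} = {-1/4, 1/4}"
proof
  show "critical_values S7 nu - {0} \<subseteq> {-1/4, 1/4}"
    using critical_nonzero(6) unfolding critical_values_def by (force simp: abs_if split: if_splits)
  have "s \<in> critical_values S7 nu - {0}" if "\<bar>s\<bar> = 1/4" for s
  proof -
    have "s \<noteq> 0" using that by auto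
    then show ?thesis
      using critical_level_nonempty[OF that] unfolding critical_values_def level_set_def
      by (auto intro: rev_image_eqI)
  qed
  then show "{-1/4, 1/4} \<subseteq> critical_values S7 nu - {0}" by auto
qed

section \<open>The two extremal critical sets\<close>

lemma celementary_on_vec_nth:
  "celementary_on U (\<lambda>u :: complex ^ 'n. u $ i)"
  using elementary_on.inner[of U "axis i (1 :: complex)"] elementary_on.inner[of U "axis i \<i>"]
  by (simp add: celementary_on_def inner_axis)

text \<open>Three coordinates range freely over the circle of radius \<open>1/2\<close>, and the
  prescribed product determines the fourth: the set is a graph over a three-torus.\<close>

lemma diffeomorphic_critical_level:
  assumes s: "\<bar>s\<bar> = 1/4"
  shows "diffeomorphic (critical_points S7 nu \<inter> level_set s) T3"
proof -
  let ?C = "critical_points S7 nu \<inter> level_set s"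
  define f where "f x = (\<chi> i :: 3. 2 * (if i = 1 then z1 x else if i = 2 then z2 x else z3 x))"
    for x :: "real^8"
  have f_nth: "f x $ 1 = 2 * z1 x" "f x $ 2 = 2 * z2 x" "f x $ 3 = 2 * z3 x" for x
    by (simp_all add: f_def)
  \<comment> \<open>The last entry solves \<open>z_prod = \<i> * of_real (s / 4)\<close>. On the
    torus the reciprocal of a phase is its conjugate, which keeps \<open>g\<close>
    polynomial.\<close>
  define g where "g u = of_z (1/2 * u $ 1) (1/2 * u $ 2) (1/2 * u $ 3)
    (\<i> * of_real (2 * s) * cnj (u $ 1 * u $ 2 * u $ 3))" for u :: "complex^3"
  have f_T3: "f x \<in> T3" if "x \<in> ?C" for x
    using that unfolding critical_level_iff[OF s] T3_def by (simp add: forall_3 f_nth norm_mult)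
  have unit: "u * cnj u = 1" if "cmod u = 1" for u
    using that complex_norm_square[of u] by simp
  have g_C: "g u \<in> ?C" if "u \<in> T3" for u
  proof -
    have u: "cmod (u $ 1) = 1" "cmod (u $ 2) = 1" "cmod (u $ 3) = 1"
      using that by (auto simp: T3_def)
    have "z_prod (g u) = \<i> * of_real (s / 4) *
        ((u $ 1 * cnj (u $ 1)) * (u $ 2 * cnj (u $ 2)) * (u $ 3 * cnj (u $ 3)))"
      by (simp add: z_prod_def g_def mult_ac)
    then show ?thesis
      unfolding critical_level_iff[OF s] by (simp add: g_def norm_mult u unit s)
  qed
  have gf: "g (f x) = x" if "x \<in> ?C" for x
  proof -
    let ?w = "z1 x * z2 x * z3 x"
    have x: "cmod (z1 x) = 1/2" "cmod (z2 x) = 1/2" "cmod (z3 x) = 1/2"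
        "z_prod x = \<i> * of_real (s / 4)"
      using that unfolding critical_level_iff[OF s] by auto
    \<comment> \<open>As \<open>?w\<close> has modulus \<open>1/8\<close>, multiplying by
      \<open>cnj ?w\<close> replaces the division by \<open>?w\<close>.\<close>
    have w: "of_real (1/64) = ?w * cnj ?w"
      unfolding complex_norm_square[symmetric] by (simp add: norm_mult x power_divide)
    have "z4 x * of_real (1/64) = z_prod x * cnj ?w"
      unfolding w by (simp add: z_prod_def mult_ac)
    then have "z4 x = \<i> * of_real (2 * s) * cnj ((2 * z1 x) * (2 * z2 x) * (2 * z3 x))"
      unfolding x(4) by (simp add: field_simps)
    then show ?thesis by (intro z_eqI) (simp_all add: g_def f_nth)
  qed
  have fg: "f (g u) = u" for u
    by (simp add: vec_eq_iff forall_3 f_nth g_def)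
  have "smooth_map ?C f"
  proof (rule smooth_map_open[of UNIV])
    have "elementary_on UNIV (\<lambda>x. f x \<bullet> b)" if b: "b \<in> Basis" for b
    proof -
      obtain i c where "b = axis i c" using b by (auto simp: Basis_vec_def)
      moreover have c: "celementary_on UNIV (\<lambda>x. f x $ i)"
        using exhaust_3[of i] by (auto simp: f_nth intro!: celementary_on_intros)
      ultimately show ?thesis
        by (auto simp: inner_axis inner_complex_def celementary_on_def intro!: elementary_on_intros)
    qed
    then show "smooth_on UNIV f" by (rule smooth_on_elementary[OF open_UNIV])
  qed auto
  moreover have "smooth_map T3 g"
  proof (rule smooth_map_open[of UNIV])
    show "smooth_on UNIV g"
      unfolding g_def[abs_def]
      by (intro smooth_on_elementary_vec open_UNIV elementary_on_of_z celementary_on_intros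
          celementary_on_vec_nth)
  qed auto
  moreover have "f ` ?C = T3"
  proof (intro equalityI image_subsetI f_T3 subsetI)
    show "u \<in> f ` ?C" if "u \<in> T3" for u
      using g_C[OF that] by (intro image_eqI[of u f "g u"]) (simp_all only: fg)
  qed
  moreover have "g ` T3 = ?C"
  proof (intro equalityI image_subsetI g_C subsetI)
    show "x \<in> g ` T3" if "x \<in> ?C" for x
      using f_T3[OF that] gf[OF that] by (intro image_eqI[of x g "f x"]) simp_all
  qed
  ultimately show ?thesis
    unfolding diffeomorphic_def using gf fg by (intro exI[of _ f] exI[of _ g] conjI ballI)
qed

section \<open>Quotients of compact sets\<close>

text \<open>A continuous map from a compact space onto a Hausdorff one is a quotient map. Since
  \<open>q\<close> and \<open>f\<close> have the same fibres on \<open>M\<close>, \<open>f\<close>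
  descends to an injective quotient map, which is a homeomorphism.\<close>

lemma homeomorphic_map_quotient_compact:
  fixes f :: "'a::t2_space \<Rightarrow> 'b::metric_space"
  assumes M: "compact M" and f: "continuous_on M f"
    and q: "\<forall>x\<in>M. \<forall>y\<in>M. q x = q y \<longleftrightarrow> f x = f y"
  shows "\<exists>F. homeomorphic_map (quotient_topology (top_of_set M) q) (top_of_set (f ` M)) F \<and>
    (\<forall>x\<in>M. F (q x) = f x)"
proof -
  let ?Q = "quotient_topology (top_of_set M) q"
  \<comment> \<open>The choice of representative is immaterial over \<open>M\<close>, where
    \<open>f\<close> is constant on the fibres of \<open>q\<close>.\<close>
  define F where "F a = f (SOME x. x \<in> M \<and> q x = a)" for a
  have Fq: "F (q x) = f x" if "x \<in> M" for x
    unfolding F_def using someI[of "\<lambda>y. y \<in> M \<and> q y = q x" x] that q by auto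
  have quot: "quotient_map (top_of_set M) ?Q q"
    by (rule quotient_map_quotient_topology)
  then have top: "topspace ?Q = q ` M"
    by (metis quotient_imp_surjective_map topspace_euclidean_subtopology)
  have cont: "continuous_map (top_of_set M) (top_of_set (f ` M)) f"
    using f by simp
  have Fq_cont: "continuous_map (top_of_set M) (top_of_set (f ` M)) (F \<circ> q)"
    using continuous_map_eq[OF cont] Fq by simp
  have "quotient_map (top_of_set M) (top_of_set (f ` M)) f"
    using M cont by (intro continuous_imp_quotient_map)
      (auto simp: compact_space_subtopology intro!: Hausdorff_space_subtopology)
  then have "quotient_map (top_of_set M) (top_of_set (f ` M)) (F \<circ> q)"
    by (rule quotient_map_eq) (simp add: Fq)
  then have "quotient_map ?Q (top_of_set (f ` M)) F"
    using quotient_map_from_composition continuous_compose_quotient_map[OF quot Fq_cont]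
      quotient_imp_continuous_map[OF quot] by blast
  moreover have "inj_on F (topspace ?Q)"
    unfolding top using q Fq by (auto simp: inj_on_def)
  ultimately show ?thesis using Fq by (auto simp: homeomorphic_map_def)
qed

section \<open>The complete graph on four vertices\<close>

text \<open>The face of the standard simplex spanned by the vertices with index in \<open>S\<close>;
  two-element sets give the edges.\<close>

definition simplex_face :: "'n::finite set \<Rightarrow> (real ^ 'n) set" where
  "simplex_face S = {r. (\<forall>i. r $ i \<ge> 0) \<and> (\<Sum>i\<in>UNIV. r $ i) = 1 \<and> (\<forall>i. i \<notin> S \<longrightarrow> r $ i = 0)}"

lemma axis_in_simplex_face_iff: "axis i 1 \<in> simplex_face S \<longleftrightarrow> i \<in> S"
  by (auto simp: simplex_face_def axis_def)

lemma simplex_face_singleton: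
  assumes "r \<in> simplex_face S" "\<And>k. k \<noteq> i \<Longrightarrow> r $ k = 0"
  shows "r = axis i 1"
proof -
  have "(\<Sum>k\<in>UNIV. r $ k) = (\<Sum>k\<in>UNIV. if k = i then r $ i else 0)"
    using assms(2) by (intro sum.cong) auto
  then have "r $ i = 1" using assms(1) by (simp add: simplex_face_def)
  then show ?thesis using assms(2) by (auto simp: vec_eq_iff axis_def)
qed

text \<open>Different pairs share at most one index, so a common point has only one coordinate that
  can be non-zero and is a vertex.\<close>

lemma simplex_edges_disjoint:
  assumes "card S = 2" "card T = 2" "S \<noteq> T" "r \<in> simplex_face S" "r \<in> simplex_face T"
  obtains i where "i \<in> S" "r = axis i 1"
proof -
  have fin: "finite T" using assms(2) by (simp add: card_ge_0_finite)
  have "\<not> S \<subseteq> T" using card_subset_eq[OF fin] assms(1-3) by metis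
  then obtain j where j: "j \<in> S" "j \<notin> T" by blast
  obtain i where i: "S = {i, j}" "i \<noteq> j"
    using assms(1) j(1) unfolding card_2_iff by auto
  have "r = axis i 1"
  proof (rule simplex_face_singleton[OF assms(4)])
    show "r $ k = 0" if "k \<noteq> i" for k
      using assms(4,5) i j that by (auto simp: simplex_face_def)
  qed
  then show ?thesis using that i by blast
qed

text \<open>The \<open>j\<close>-th coordinate inverts the affine parametrisation.\<close>

lemma simplex_edge_arc:
  assumes "i \<noteq> j"
  shows "homeomorphic_map (top_of_set {0..1}) (top_of_set (simplex_face {i, j}))
    (\<lambda>t. (1 - t) *\<^sub>R axis i 1 + t *\<^sub>R axis j 1)"
proof -
  let ?g = "\<lambda>t :: real. (1 - t) *\<^sub>R axis i 1 + t *\<^sub>R axis j (1 :: real)"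
  have sum: "r $ i + r $ j = 1" if "r \<in> simplex_face {i, j}" for r
  proof -
    have "(\<Sum>k\<in>UNIV. r $ k) = (\<Sum>k\<in>{i, j}. r $ k)"
      using that by (intro sum.mono_neutral_right) (auto simp: simplex_face_def)
    then show ?thesis using that assms by (simp add: simplex_face_def)
  qed
  have mem: "?g t \<in> simplex_face {i, j}" if "t \<in> {0..1}" for t
    using that by (auto simp: simplex_face_def axis_def sum.distrib sum_distrib_left[symmetric])
  have "homeomorphic_maps (top_of_set {0..1}) (top_of_set (simplex_face {i, j})) ?g (\<lambda>r. r $ j)"
    unfolding homeomorphic_maps_def
  proof (intro conjI)
    show "continuous_map (top_of_set {0..1}) (top_of_set (simplex_face {i, j})) ?g"
      using mem by (auto intro!: continuous_intros)
    show "continuous_map (top_of_set (simplex_face {i, j})) (top_of_set {0..1}) (\<lambda>r. r $ j)"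
    proof -
      have "r $ j \<le> 1" if "r \<in> simplex_face {i, j}" for r
        using sum[OF that] that unfolding simplex_face_def by (smt (verit) mem_Collect_eq)
      then show ?thesis
        by (auto intro!: continuous_intros simp: simplex_face_def)
    qed
    show "\<forall>x\<in>topspace (top_of_set {0..1}). ?g x $ j = x"
      using assms by (simp add: axis_def)
    show "\<forall>y\<in>topspace (top_of_set (simplex_face {i, j})). ?g (y $ j) = y"
    proof
      fix y assume "y \<in> topspace (top_of_set (simplex_face {i, j}))"
      then have y: "y \<in> simplex_face {i, j}" by simp
      show "?g (y $ j) = y"
        using y sum[OF y] assms by (auto simp: vec_eq_iff axis_def simplex_face_def)
    qed
  qed
  then show ?thesis using homeomorphic_map_maps by blast
qed

text \<open>The union of the edges is the one-skeleton of a tetrahedron. The inverse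
  \<open>G\<close> of the homeomorphism carries vertices and edges to \<open>X\<close>, where
  incidence becomes membership of an index in a two-element subset of a four-element set.\<close>

lemma complete_graph_4:
  fixes X :: "'p topology"
  assumes H: "homeomorphic_map X (top_of_set (\<Union>S\<in>{S :: 4 set. card S = 2}. simplex_face S)) H"
  shows "\<exists>W E. topological_graph X W E \<and> card W = 4 \<and> card E = 6 \<and>
        (\<forall>v\<in>W. card {e \<in> E. v \<in> e} = 3) \<and>
        (\<forall>v\<in>W. \<forall>w\<in>W. v \<noteq> w \<longrightarrow> (\<exists>!e. e \<in> E \<and> e \<inter> W = {v, w}))"
proof -
  let ?P = "{S :: 4 set. card S = 2}"
  let ?K = "\<Union>S\<in>?P. simplex_face S"
  obtain G where HG: "homeomorphic_maps X (top_of_set ?K) H G"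
    using H homeomorphic_map_maps by blast
  then have G: "homeomorphic_map (top_of_set ?K) X G"
    using homeomorphic_maps_map by blast
  have GK: "G ` ?K = topspace X"
    using homeomorphic_imp_surjective_map[OF G] by simp
  have inj: "inj_on G ?K"
    using homeomorphic_imp_injective_map[OF G] by simp
  have face_K: "simplex_face S \<subseteq> ?K" if "card S = 2" for S
    using that by blast
  \<comment> \<open>A second index is what places every vertex on some edge.\<close>
  have pair: "\<exists>j. i \<noteq> j" for i :: 4
  proof -
    have "i \<noteq> 1 \<or> i \<noteq> 2" by auto
    then show ?thesis by blast
  qed
  have axis_K: "axis i 1 \<in> ?K" for i
  proof -
    obtain j where "i \<noteq> j" using pair by blast
    then have "axis i 1 \<in> simplex_face {i, j}" "card {i, j} = 2"
      by (simp_all add: axis_in_simplex_face_iff)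
    then show ?thesis by blast
  qed
  define v where "v i = G (axis i 1)" for i
  define e where "e S = G ` simplex_face S" for S
  let ?W = "range v" and ?E = "e ` ?P"
  have v_eq_iff: "v i = v j \<longleftrightarrow> i = j" for i j
    using inj_onD[OF inj _ axis_K axis_K, of i j] by (auto simp: v_def axis_eq_axis)
  have v_in_e: "v i \<in> e S \<longleftrightarrow> i \<in> S" if "card S = 2" for i S
    using inj_on_image_mem_iff[OF inj axis_K face_K[OF that]]
    by (simp add: v_def e_def axis_in_simplex_face_iff)
  have e_W: "e S \<inter> ?W = v ` S" if "card S = 2" for S
    using v_in_e[OF that] by blast
  have v_image_eq_iff: "v ` S = v ` T \<longleftrightarrow> S = T" for S T
    using v_eq_iff by (intro inj_image_eq_iff) (auto simp: inj_def)
  have e_eq_iff: "e S = e T \<longleftrightarrow> S = T" if "card S = 2" "card T = 2" for S T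
    using e_W that v_image_eq_iff by metis
  have "topological_graph X ?W ?E"
    unfolding topological_graph_def
  proof (intro conjI ballI impI)
    show "Hausdorff_space X"
      using homeomorphic_Hausdorff_space[OF homeomorphic_map_imp_homeomorphic_space[OF H]]
        Hausdorff_space_subtopology[OF Hausdorff_space_euclidean] by blast
    have "?W \<subseteq> topspace X" using axis_K GK by (auto simp: v_def)
    moreover have "\<Union>?E = topspace X" by (simp add: e_def GK[symmetric] image_UN)
    ultimately show "?W \<union> \<Union>?E = topspace X" by blast
    show "finite ?W" "finite ?E" by simp_all
  next
    fix f assume "f \<in> ?E"
    then obtain S where S: "card S = 2" "f = e S" by blast
    then obtain i j where ij: "S = {i, j}" "i \<noteq> j" by (auto simp: card_2_iff)
    have "arc_between X f (v i) (v j)"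
      unfolding arc_between_def
    proof (intro conjI exI[of _ "G \<circ> (\<lambda>t. (1 - t) *\<^sub>R axis i 1 + t *\<^sub>R axis j 1)"])
      show "f \<subseteq> topspace X" using face_K[OF S(1)] GK by (auto simp: S e_def)
      have "homeomorphic_map (subtopology (top_of_set ?K) (simplex_face S))
          (subtopology X (e S)) G"
        using face_K[OF S(1)] GK
        by (intro homeomorphic_map_subtopologies[OF G]) (auto simp: e_def)
      moreover have "subtopology (top_of_set ?K) (simplex_face S) = top_of_set (simplex_face S)"
        using face_K[OF S(1)] by (simp add: subtopology_subtopology inf.absorb2)
      ultimately have "homeomorphic_map (top_of_set (simplex_face {i, j})) (subtopology X f) G"
        unfolding S(2) ij(1) by (simp only:)
      then show "homeomorphic_map (top_of_set {0..1}) (subtopology X f)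
          (G \<circ> (\<lambda>t. (1 - t) *\<^sub>R axis i 1 + t *\<^sub>R axis j 1))"
        by (rule homeomorphic_map_compose[OF simplex_edge_arc[OF ij(2)]])
    qed (simp_all add: v_def)
    moreover have "f \<inter> ?W = {v i, v j}" using e_W[OF S(1)] S(2) ij(1) by simp
    ultimately show "\<exists>x y. x \<noteq> y \<and> f \<inter> ?W = {x, y} \<and> arc_between X f x y"
      using ij(2) v_eq_iff by blast
  next
    fix f g assume "f \<in> ?E" "g \<in> ?E" "f \<noteq> g"
    then obtain S T where ST: "card S = 2" "f = e S" "card T = 2" "g = e T" "S \<noteq> T" by blast
    have "f \<inter> g = G ` (simplex_face S \<inter> simplex_face T)"
      using inj_on_image_Int[OF inj face_K[OF ST(1)] face_K[OF ST(3)]] by (simp add: ST e_def)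
    also have "\<dots> \<subseteq> ?W"
    proof (rule image_subsetI)
      fix r assume "r \<in> simplex_face S \<inter> simplex_face T"
      then obtain i where "r = axis i 1"
        using simplex_edges_disjoint[OF ST(1,3,5)] by blast
      then show "G r \<in> ?W" by (simp add: v_def)
    qed
    finally show "f \<inter> g \<subseteq> ?W" .
  qed
  moreover have "card ?W = 4"
    using v_eq_iff by (subst card_image) (auto simp: inj_def)
  moreover have "card ?E = 6"
  proof -
    have "card ?E = card ?P"
      using e_eq_iff by (intro card_image inj_onI) auto
    also have "\<dots> = card {S. S \<subseteq> (UNIV :: 4 set) \<and> card S = 2}" by simp
    also have "\<dots> = 4 choose 2" by (subst n_subsets) simp_all
    finally show ?thesis by (simp add: choose_two)
  qed
  moreover have "card {f \<in> ?E. u \<in> f} = 3" if "u \<in> ?W" for u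
  proof -
    from that obtain i where u: "u = v i" by (rule rangeE)
    \<comment> \<open>The edges at a vertex are counted by their other end, for which three indices
      remain.\<close>
    have "{f \<in> ?E. u \<in> f} = (\<lambda>j. e {i, j}) ` (UNIV - {i})"
    proof (intro equalityI subsetI)
      fix f assume "f \<in> {f \<in> ?E. u \<in> f}"
      then obtain S where S: "card S = 2" "f = e S" "i \<in> S" using v_in_e u by auto
      then obtain j where "S = {i, j}" "i \<noteq> j" by (auto simp: card_2_iff)
      then show "f \<in> (\<lambda>j. e {i, j}) ` (UNIV - {i})" using S by blast
    next
      fix f assume "f \<in> (\<lambda>j. e {i, j}) ` (UNIV - {i})"
      then obtain j where j: "f = e {i, j}" "i \<noteq> j" by blast
      then have "card {i, j} = 2" by simp
      then show "f \<in> {f \<in> ?E. u \<in> f}" using v_in_e[of "{i, j}" i] j u by auto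
    qed
    moreover have "inj_on (\<lambda>j. e {i, j}) (UNIV - {i})"
    proof (rule inj_onI)
      fix j k assume jk: "j \<in> UNIV - {i}" "k \<in> UNIV - {i}" "e {i, j} = e {i, k}"
      then have "{i, j} = {i, k}" using e_eq_iff[of "{i, j}" "{i, k}"] by auto
      then show "j = k" by (auto simp: doubleton_eq_iff)
    qed
    ultimately have "card {f \<in> ?E. u \<in> f} = card (UNIV - {i})" by (simp add: card_image)
    then show ?thesis by simp
  qed
  moreover have "\<exists>!f. f \<in> ?E \<and> f \<inter> ?W = {u, w}" if "u \<in> ?W" "w \<in> ?W" "u \<noteq> w" for u w
  proof -
    obtain i j where ij: "u = v i" "w = v j" "i \<noteq> j" using \<open>u \<in> ?W\<close> \<open>w \<in> ?W\<close> \<open>u \<noteq> w\<close> by blast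
    have uw: "{u, w} = v ` {i, j}" and c: "card {i, j} = 2" using ij by simp_all
    show ?thesis
    proof (rule ex1I[of _ "e {i, j}"])
      show "e {i, j} \<in> ?E \<and> e {i, j} \<inter> ?W = {u, w}"
        using e_W[OF c] c uw by simp
      fix f assume f: "f \<in> ?E \<and> f \<inter> ?W = {u, w}"
      then obtain S where S: "card S = 2" "f = e S" by blast
      then have "v ` S = v ` {i, j}" using e_W[OF S(1)] f uw by simp
      then have "S = {i, j}" by (simp only: v_image_eq_iff)
      then show "f = e {i, j}" by (simp only: S(2))
    qed
  qed
  ultimately show ?thesis by (intro exI[of _ ?W] exI[of _ ?E] conjI ballI impI) simp_all
qed

section \<open>The critical points in the zero level\<close>

text \<open>Squares are used because they turn the sphere equation into the affine condition that
  the entries sum to 1.\<close>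

definition moduli :: "real^8 \<Rightarrow> real^4" where
  "moduli x = vector [(cmod (z1 x))\<^sup>2, (cmod (z2 x))\<^sup>2, (cmod (z3 x))\<^sup>2, (cmod (z4 x))\<^sup>2]"

lemma moduli_nth:
  "moduli x $ 1 = (cmod (z1 x))\<^sup>2" "moduli x $ 2 = (cmod (z2 x))\<^sup>2"
  "moduli x $ 3 = (cmod (z3 x))\<^sup>2" "moduli x $ 4 = (cmod (z4 x))\<^sup>2"
  by (simp_all add: moduli_def vector_4)

lemma moduli_eq_iff: "moduli x = moduli y \<longleftrightarrow> cmod (z1 x) = cmod (z1 y) \<and>
    cmod (z2 x) = cmod (z2 y) \<and> cmod (z3 x) = cmod (z3 y) \<and> cmod (z4 x) = cmod (z4 y)"
  by (simp add: vec_eq_iff forall_4 moduli_nth power2_eq_iff_nonneg)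

lemma continuous_on_z [continuous_intros]:
  assumes "continuous_on S f"
  shows "continuous_on S (\<lambda>x. z1 (f x))" "continuous_on S (\<lambda>x. z2 (f x))"
    "continuous_on S (\<lambda>x. z3 (f x))" "continuous_on S (\<lambda>x. z4 (f x))"
  using assms by (auto intro: bounded_linear.continuous_on bounded_linear_z)

text \<open>At value zero the right-hand sides of the critical equations vanish; conversely, a
  vanishing triple product already makes \<open>nu\<close> zero.\<close>

lemma critical_zero_iff:
  "x \<in> critical_points S7 nu \<inter> level_set 0 \<longleftrightarrow> x \<in> S7 \<and>
     z2 x * z3 x * z4 x = 0 \<and> z1 x * z3 x * z4 x = 0 \<and>
     z1 x * z2 x * z4 x = 0 \<and> z1 x * z2 x * z3 x = 0"
proof
  assume "x \<in> critical_points S7 nu \<inter> level_set 0"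
  then show "x \<in> S7 \<and> z2 x * z3 x * z4 x = 0 \<and> z1 x * z3 x * z4 x = 0 \<and>
     z1 x * z2 x * z4 x = 0 \<and> z1 x * z2 x * z3 x = 0"
    by (simp add: critical_points_iff level_set_def)
next
  assume x: "x \<in> S7 \<and> z2 x * z3 x * z4 x = 0 \<and> z1 x * z3 x * z4 x = 0 \<and>
     z1 x * z2 x * z4 x = 0 \<and> z1 x * z2 x * z3 x = 0"
  then have "nu x = 0" by (auto simp: nu_eq)
  with x show "x \<in> critical_points S7 nu \<inter> level_set 0"
    by (simp add: critical_points_iff level_set_def)
qed

text \<open>Four numbers whose triple products all vanish include at least two zeros, so the moduli
  lie on an edge. In the other direction, real square roots lift each point of an edge.\<close>

lemma moduli_critical_zero:
  "moduli ` (critical_points S7 nu \<inter> level_set 0) = (\<Union>S\<in>{S. card S = 2}. simplex_face S)"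
proof (intro equalityI subsetI)
  fix r assume "r \<in> moduli ` (critical_points S7 nu \<inter> level_set 0)"
  then obtain x where x: "r = moduli x" "x \<in> critical_points S7 nu \<inter> level_set 0" by blast
  have *: "r \<in> (\<Union>S\<in>{S. card S = 2}. simplex_face S)" if "i \<noteq> j" "\<And>k. k \<notin> {i, j} \<Longrightarrow> r $ k = 0" for i j
  proof -
    have "r \<in> simplex_face {i, j}"
      unfolding simplex_face_def
    proof (intro CollectI conjI)
      show "\<forall>k. r $ k \<ge> 0" by (simp add: x forall_4 moduli_nth)
      show "(\<Sum>k\<in>UNIV. r $ k) = 1"
        using x(2) by (simp add: x(1) sum_4 moduli_nth critical_zero_iff S7_iff del: Int_iff)
    qed (use that(2) in blast)
    moreover have "card {i, j} = 2" using that(1) by simp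
    ultimately show ?thesis by blast
  qed
  have zero: "r $ k = 0 \<longleftrightarrow> (k = 1 \<and> z1 x = 0) \<or> (k = 2 \<and> z2 x = 0) \<or> (k = 3 \<and> z3 x = 0) \<or>
      (k = 4 \<and> z4 x = 0)" for k
    using exhaust_4[of k] by (auto simp: x moduli_nth)
  consider "z1 x = 0" "z2 x = 0" | "z1 x = 0" "z3 x = 0" | "z1 x = 0" "z4 x = 0"
    | "z2 x = 0" "z3 x = 0" | "z2 x = 0" "z4 x = 0" | "z3 x = 0" "z4 x = 0"
    using x(2) unfolding critical_zero_iff by fastforce
  then show "r \<in> (\<Union>S\<in>{S. card S = 2}. simplex_face S)"
  proof cases
    case 1 then show ?thesis by (intro *[of 3 4]) (simp, use exhaust_4 zero in blast)
  next
    case 2 then show ?thesis by (intro *[of 2 4]) (simp, use exhaust_4 zero in blast)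
  next
    case 3 then show ?thesis by (intro *[of 2 3]) (simp, use exhaust_4 zero in blast)
  next
    case 4 then show ?thesis by (intro *[of 1 4]) (simp, use exhaust_4 zero in blast)
  next
    case 5 then show ?thesis by (intro *[of 1 3]) (simp, use exhaust_4 zero in blast)
  next
    case 6 then show ?thesis by (intro *[of 1 2]) (simp, use exhaust_4 zero in blast)
  qed
next
  fix r :: "real^4" assume "r \<in> (\<Union>S\<in>{S. card S = 2}. simplex_face S)"
  then obtain S where S: "card S = 2" "r \<in> simplex_face S" by blast
  have ex_4: "(\<exists>j::4. P j) \<longleftrightarrow> P 1 \<or> P 2 \<or> P 3 \<or> P 4" for P by (metis exhaust_4)
  have pos: "r $ i \<ge> 0" for i using S(2) by (simp add: simplex_face_def)
  define x where "x = of_z (sqrt (r $ 1)) (sqrt (r $ 2)) (sqrt (r $ 3)) (sqrt (r $ 4))"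
  have "moduli x = r"
    using pos by (simp add: vec_eq_iff forall_4 moduli_nth x_def)
  \<comment> \<open>The two indices of \<open>S\<close> cannot exhaust the three indices other than
    \<open>i\<close>, so the triple product omitting the \<open>i\<close>-th coordinate has a zero
    factor.\<close>
  moreover have "\<exists>j. j \<noteq> i \<and> r $ j = 0" for i
  proof -
    have "card S < card (UNIV - {i})" using S(1) by simp
    then have "\<not> UNIV - {i} \<subseteq> S" by (metis card_mono finite_code not_le)
    then show ?thesis using S(2) by (auto simp: simplex_face_def)
  qed
  from this[of 1] this[of 2] this[of 3] this[of 4]
  have "x \<in> critical_points S7 nu \<inter> level_set 0"
    using pos S(2) unfolding critical_zero_iff S7_iff ex_4
    by (auto simp: x_def simplex_face_def sum_4)
  ultimately show "r \<in> moduli ` (critical_points S7 nu \<inter> level_set 0)" by blast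
qed

lemma compact_S7: "compact S7"
  by (simp add: S7_def)

lemma compact_critical_zero: "compact (critical_points S7 nu \<inter> level_set 0)"
proof -
  have "closed {x. z2 x * z3 x * z4 x = 0 \<and> z1 x * z3 x * z4 x = 0 \<and>
     z1 x * z2 x * z4 x = 0 \<and> z1 x * z2 x * z3 x = 0}"
    by (intro closed_Collect_conj closed_Collect_eq continuous_intros)
  moreover have "critical_points S7 nu \<inter> level_set 0 = S7 \<inter>
      {x. z2 x * z3 x * z4 x = 0 \<and> z1 x * z3 x * z4 x = 0 \<and>
     z1 x * z2 x * z4 x = 0 \<and> z1 x * z2 x * z3 x = 0}"
    using critical_zero_iff by blast
  ultimately show ?thesis using compact_S7 by (simp add: compact_Int_closed)
qed

lemma continuous_on_moduli: "continuous_on S moduli"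
proof -
  have "continuous_on S (\<lambda>x. moduli x $ i)" for i
    using exhaust_4[of i]
    by (elim disjE; simp add: moduli_nth; intro continuous_intros continuous_on_id)
  then have "continuous_on S (\<lambda>x. \<chi> i. moduli x $ i)" by (rule continuous_on_vec_lambda)
  then show ?thesis by simp
qed

text \<open>The product of the coordinates vanishes throughout this set, so the moduli alone
  separate orbits and identify the compact quotient with the edges of the simplex.\<close>

lemma critical_zero_graph:
  "\<exists>W E. topological_graph (orbit_space (critical_points S7 nu \<inter> level_set 0)) W E \<and>
     card W = 4 \<and> card E = 6 \<and> (\<forall>v\<in>W. card {e \<in> E. v \<in> e} = 3) \<and>
     (\<forall>v\<in>W. \<forall>w\<in>W. v \<noteq> w \<longrightarrow> (\<exists>!e. e \<in> E \<and> e \<inter> W = {v, w}))"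
proof -
  let ?C = "critical_points S7 nu \<inter> level_set 0"
  have zero: "z_prod x = 0" if "x \<in> ?C" for x
    using that unfolding critical_zero_iff z_prod_def by simp
  have orbits: "\<forall>x\<in>?C. \<forall>y\<in>?C. T3_orbit x = T3_orbit y \<longleftrightarrow> moduli x = moduli y"
    unfolding T3_orbit_eq_iff moduli_eq_iff by (intro ballI) (simp only: zero simp_thms)
  obtain F where "homeomorphic_map (orbit_space ?C) (top_of_set (moduli ` ?C)) F"
    using homeomorphic_map_quotient_compact[OF compact_critical_zero continuous_on_moduli orbits]
    by (elim exE conjE)
  then show ?thesis unfolding moduli_critical_zero by (rule complete_graph_4)
qed

section \<open>Stereographic charts\<close>

text \<open>Projection from the pole with \<open>y $ 4 = \<epsilon>\<close>; the sign 1 or -1 lets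
  both charts of the sphere be treated at once.\<close>

definition stereo :: "real \<Rightarrow> real^4 \<Rightarrow> real^3" where
  "stereo \<epsilon> y = (1 / (1 - \<epsilon> * y $ 4)) *\<^sub>R vector [y $ 1, y $ 2, y $ 3]"

definition stereo_inv :: "real \<Rightarrow> real^3 \<Rightarrow> real^4" where
  "stereo_inv \<epsilon> x = (1 / (1 + x \<bullet> x)) *\<^sub>R
     vector [2 * x $ 1, 2 * x $ 2, 2 * x $ 3, \<epsilon> * (x \<bullet> x - 1)]"

lemma stereo_nth:
  "stereo \<epsilon> y $ 1 = y $ 1 / (1 - \<epsilon> * y $ 4)" "stereo \<epsilon> y $ 2 = y $ 2 / (1 - \<epsilon> * y $ 4)"
  "stereo \<epsilon> y $ 3 = y $ 3 / (1 - \<epsilon> * y $ 4)"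
  by (simp_all add: stereo_def)

lemma stereo_inv_nth:
  "stereo_inv \<epsilon> x $ 1 = 2 * x $ 1 / (1 + x \<bullet> x)" "stereo_inv \<epsilon> x $ 2 = 2 * x $ 2 / (1 + x \<bullet> x)"
  "stereo_inv \<epsilon> x $ 3 = 2 * x $ 3 / (1 + x \<bullet> x)"
  "stereo_inv \<epsilon> x $ 4 = \<epsilon> * (x \<bullet> x - 1) / (1 + x \<bullet> x)"
  by (simp_all add: stereo_inv_def vector_4)

lemma inner_vec3: "(x :: real^3) \<bullet> x = (x $ 1)\<^sup>2 + (x $ 2)\<^sup>2 + (x $ 3)\<^sup>2"
  by (simp add: inner_vec_def sum_3 power2_eq_square)

lemma sphere_vec4_iff:
  "y \<in> sphere (0 :: real^4) 1 \<longleftrightarrow> (y $ 1)\<^sup>2 + (y $ 2)\<^sup>2 + (y $ 3)\<^sup>2 + (y $ 4)\<^sup>2 = 1"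
  by (simp add: norm_eq_1 inner_vec_def sum_4 power2_eq_square)

lemma one_plus_inner_pos: "1 + x \<bullet> x > 0" for x :: "real^3"
  by (simp add: add_pos_nonneg)

lemma stereo_inv_pole:
  assumes "\<epsilon> \<in> {1, -1}"
  shows "1 - \<epsilon> * stereo_inv \<epsilon> x $ 4 = 2 / (1 + x \<bullet> x)"
  using assms one_plus_inner_pos[of x] by (auto simp: stereo_inv_nth field_simps)

lemma stereo_inv_in_sphere:
  assumes "\<epsilon> \<in> {1, -1}"
  shows "stereo_inv \<epsilon> x \<in> sphere 0 1"
proof -
  let ?d = "1 + x \<bullet> x"
  have "(2 * x $ 1)\<^sup>2 + (2 * x $ 2)\<^sup>2 + (2 * x $ 3)\<^sup>2 + (\<epsilon> * (x \<bullet> x - 1))\<^sup>2 = ?d\<^sup>2"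
  proof -
    have "\<epsilon>\<^sup>2 = 1" using assms by auto
    then have "(2 * x $ 1)\<^sup>2 + (2 * x $ 2)\<^sup>2 + (2 * x $ 3)\<^sup>2 + (\<epsilon> * (x \<bullet> x - 1))\<^sup>2 =
        4 * (x \<bullet> x) + (x \<bullet> x - 1)\<^sup>2"
      by (simp add: inner_vec3 power_mult_distrib)
    then show ?thesis by (simp add: power2_eq_square algebra_simps)
  qed
  then show ?thesis
    unfolding sphere_vec4_iff stereo_inv_nth power_divide
    using one_plus_inner_pos[of x] by (simp flip: add_divide_distrib)
qed

lemma stereo_inv_ne_pole:
  assumes "\<epsilon> \<in> {1, -1}"
  shows "stereo_inv \<epsilon> x $ 4 \<noteq> \<epsilon>"
  using stereo_inv_pole[OF assms, of x] one_plus_inner_pos[of x] assms by auto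

lemma stereo_stereo_inv:
  assumes "\<epsilon> \<in> {1, -1}"
  shows "stereo \<epsilon> (stereo_inv \<epsilon> x) = x"
  using one_plus_inner_pos[of x]
  by (simp add: vec_eq_iff forall_3 stereo_nth stereo_inv_pole[OF assms] stereo_inv_nth(1-3))

lemma stereo_inv_stereo:
  assumes "\<epsilon> \<in> {1, -1}" "y \<in> sphere 0 1" "y $ 4 \<noteq> \<epsilon>"
  shows "stereo_inv \<epsilon> (stereo \<epsilon> y) = y"
proof -
  have e: "\<epsilon> * \<epsilon> = 1" using assms(1) by auto
  \<comment> \<open>In terms of \<open>d\<close>, the first three squared coordinates sum to
    \<open>d * (2 - d)\<close> on the sphere, and one plus the squared norm of the projected point
    collapses to \<open>2 / d\<close>.\<close>
  define d where "d = 1 - \<epsilon> * y $ 4"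
  have d: "d \<noteq> 0" using assms(1,3) by (auto simp: d_def)
  have "stereo \<epsilon> y \<bullet> stereo \<epsilon> y = ((y $ 1)\<^sup>2 + (y $ 2)\<^sup>2 + (y $ 3)\<^sup>2) / d\<^sup>2"
    by (simp add: inner_vec3 stereo_nth power_divide add_divide_distrib d_def)
  also have "(y $ 1)\<^sup>2 + (y $ 2)\<^sup>2 + (y $ 3)\<^sup>2 = d * (2 - d)"
    using assms(2) e unfolding sphere_vec4_iff d_def by algebra
  also have "d * (2 - d) / d\<^sup>2 = (2 - d) / d" using d by (simp add: power2_eq_square)
  finally have n: "stereo \<epsilon> y \<bullet> stereo \<epsilon> y = (2 - d) / d" .
  have n1: "1 + stereo \<epsilon> y \<bullet> stereo \<epsilon> y = 2 / d" unfolding n using d by (simp add: field_simps)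
  have "\<epsilon> * ((2 - d) / d - 1) / (2 / d) = \<epsilon> * (1 - d)"
    using d by (simp add: field_simps)
  also have "\<dots> = y $ 4" using e by (simp add: d_def mult.assoc[symmetric])
  finally have "stereo_inv \<epsilon> (stereo \<epsilon> y) $ 4 = y $ 4"
    unfolding stereo_inv_nth n1 by (simp add: n)
  then show ?thesis
    using d unfolding vec_eq_iff forall_4 stereo_inv_nth(1-3) n1
    by (simp add: stereo_nth d_def[symmetric])
qed

lemma elementary_on_stereo:
  assumes "\<And>y. y \<in> U \<Longrightarrow> \<epsilon> * y $ 4 \<noteq> 1"
  shows "elementary_on U (\<lambda>y. stereo \<epsilon> y $ i)"
  using exhaust_3[of i] assms by (auto simp: stereo_nth intro!: elementary_on_intros)

lemma elementary_on_stereo_inv: "elementary_on U (\<lambda>x. stereo_inv \<epsilon> x $ i)"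
proof -
  have "elementary_on U (\<lambda>x :: real^3. x \<bullet> x)"
    unfolding inner_vec3 by (intro elementary_on_intros)
  moreover have "1 + x \<bullet> x \<noteq> 0" for x :: "real^3" using one_plus_inner_pos[of x] by simp
  ultimately show ?thesis
    using exhaust_4[of i] by (elim disjE; simp only: stereo_inv_nth; intro elementary_on_intros)
qed

lemma continuous_on_elementary_vec:
  fixes f :: "'a::euclidean_space \<Rightarrow> real ^ 'n"
  assumes "\<And>i. elementary_on U (\<lambda>x. f x $ i)"
  shows "continuous_on U f"
proof -
  have "continuous_on U (\<lambda>x. \<chi> i. f x $ i)"
    by (intro continuous_on_vec_lambda elementary_on_imp_continuous_on assms)
  then show ?thesis by simp
qed

lemma stereo_homeomorphic_map:
  assumes "\<epsilon> \<in> {1, -1}"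
  shows "homeomorphic_map (top_of_set {y \<in> sphere 0 1. y $ 4 \<noteq> \<epsilon>}) (top_of_set UNIV) (stereo \<epsilon>)"
proof -
  have "\<epsilon> * y $ 4 \<noteq> 1" if "y $ 4 \<noteq> \<epsilon>" for y :: "real^4"
    using that assms by auto
  then have "continuous_on {y \<in> sphere 0 1. y $ 4 \<noteq> \<epsilon>} (stereo \<epsilon>)"
    by (intro continuous_on_elementary_vec elementary_on_stereo) auto
  moreover have "continuous_on UNIV (stereo_inv \<epsilon>)"
    by (intro continuous_on_elementary_vec elementary_on_stereo_inv)
  ultimately have "homeomorphic_maps (top_of_set {y \<in> sphere 0 1. y $ 4 \<noteq> \<epsilon>}) (top_of_set UNIV)
      (stereo \<epsilon>) (stereo_inv \<epsilon>)"
    using stereo_stereo_inv[OF assms] stereo_inv_stereo[OF assms] stereo_inv_in_sphere[OF assms]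
      stereo_inv_ne_pole[OF assms]
    unfolding homeomorphic_maps_def by (auto simp: continuous_map_in_subtopology)
  then show ?thesis using homeomorphic_map_maps by blast
qed

lemma second_countable_euclidean:
  "second_countable (euclidean :: 'a::second_countable_topology topology)"
proof -
  obtain B :: "'a set set" where B: "countable B" "\<And>V. V \<in> B \<Longrightarrow> open V"
    "\<And>S. open S \<Longrightarrow> \<exists>U. U \<subseteq> B \<and> S = \<Union>U"
    using univ_second_countable by blast
  show ?thesis
    unfolding second_countable_def
  proof (intro exI[of _ B] conjI allI impI)
    fix U and x :: 'a assume "openin euclidean U \<and> x \<in> U"
    then obtain C where "C \<subseteq> B" "U = \<Union>C" "x \<in> U" using B(3) by (metis open_openin)
    then show "\<exists>V\<in>B. x \<in> V \<and> V \<subseteq> U" by blast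
  qed (use B in auto)
qed

section \<open>Quotients diffeomorphic to the three-sphere\<close>

text \<open>Straight lines in the chart lift through the section \<open>g\<close> to smooth curves
  in \<open>M\<close>. As \<open>g\<close> passes through \<open>p\<close>, every \<open>w\<close>
  is attained there, so \<open>f\<close> is a submersion at \<open>p\<close>.\<close>

lemma stereo_curve:
  fixes \<Phi> :: "real ^ 'n \<Rightarrow> real^4"
  assumes \<epsilon>: "\<epsilon> \<in> {1, -1}" and p: "\<Phi> p \<in> sphere 0 1" "\<Phi> p $ 4 \<noteq> \<epsilon>"
    and g: "\<And>i. elementary_on UNIV (\<lambda>y. g y $ i)" "\<And>y. y \<in> sphere 0 1 \<Longrightarrow> g y \<in> M"
      "\<And>y. y \<in> sphere 0 1 \<Longrightarrow> \<Phi> (g y) = y" "g (\<Phi> p) = p"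
    and f: "\<And>x. x \<in> M \<Longrightarrow> f x = stereo \<epsilon> (\<Phi> x)"
  shows "differential_range M f p = UNIV"
proof -
  have "w \<in> differential_range M f p" for w
  proof -
    define l where "l t = stereo \<epsilon> (\<Phi> p) + t *\<^sub>R w" for t
    define \<gamma> where "\<gamma> t = g (stereo_inv \<epsilon> (l t))" for t
    have M: "\<gamma> t \<in> M" for t
      unfolding \<gamma>_def by (intro g stereo_inv_in_sphere \<epsilon>)
    have "f (\<gamma> t) = l t" for t
      unfolding f[OF M] unfolding \<gamma>_def
      by (simp only: g(3)[OF stereo_inv_in_sphere[OF \<epsilon>]] stereo_stereo_inv[OF \<epsilon>])
    then have "f \<circ> \<gamma> = l" by auto
    moreover have "(l has_vector_derivative w) (at 0)"
      unfolding l_def by (auto intro!: derivative_eq_intros)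
    moreover have "\<gamma> 0 = p"
      by (simp add: \<gamma>_def l_def stereo_inv_stereo[OF \<epsilon> p] g(4))
    moreover have "smooth_on {-1<..<1} \<gamma>"
    proof (rule smooth_on_elementary_vec)
      have "elementary_on {-1<..<1} (\<lambda>t. l t $ i)" for i
        unfolding l_def by (simp, intro elementary_on_intros)
      then have "elementary_on {-1<..<1} (\<lambda>t. stereo_inv \<epsilon> (l t) $ i)" for i
        by (intro elementary_on_compose_vec[OF elementary_on_stereo_inv[of UNIV]]) auto
      then show "elementary_on {-1<..<1} (\<lambda>t. \<gamma> t $ i)" for i
        unfolding \<gamma>_def by (intro elementary_on_compose_vec[OF g(1)]) auto
    qed simp
    ultimately show ?thesis
      using M unfolding differential_range_def smooth_curve_through_def
      by (intro CollectI exI[of _ \<gamma>] conjI exI[of _ 1]) auto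
  qed
  then show ?thesis by blast
qed

text \<open>The map \<open>\<Phi>\<close> identifies the quotient with the sphere, and the two
  stereographic charts are pulled back. Elementary formulas on the open set \<open>W\<close> make
  the projection smooth; a section through each point of \<open>M\<close> makes it a
  submersion.\<close>

lemma quotient_sphere:
  fixes \<Phi> :: "real ^ 'n \<Rightarrow> real^4" and q :: "real ^ 'n \<Rightarrow> 'p"
  assumes M: "compact M" and W: "open W" "M \<subseteq> W" and \<Phi>: "\<And>i. elementary_on W (\<lambda>x. \<Phi> x $ i)"
    and \<Phi>_M: "\<Phi> ` M = sphere 0 1"
    and q: "\<forall>x\<in>M. \<forall>y\<in>M. q x = q y \<longleftrightarrow> \<Phi> x = \<Phi> y"
    and sections: "\<And>p. p \<in> M \<Longrightarrow> \<exists>g. (\<forall>i. elementary_on UNIV (\<lambda>y. g y $ i)) \<and>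
      (\<forall>y\<in>sphere 0 1. g y \<in> M \<and> \<Phi> (g y) = y) \<and> g (\<Phi> p) = p"
  shows "\<exists>A :: ('p set \<times> ('p \<Rightarrow> real^3)) set. quotient_manifold M q A \<and>
    manifold_diffeomorphic (quotient_topology (top_of_set M) q) A (sphere (0 :: real^4) 1)"
proof -
  let ?X = "quotient_topology (top_of_set M) q" and ?S = "sphere (0 :: real^4) 1"
  have cont: "continuous_on W \<Phi>"
    by (rule continuous_on_elementary_vec) (rule \<Phi>)
  obtain F where F0: "homeomorphic_map ?X (top_of_set (\<Phi> ` M)) F"
    and "\<forall>x\<in>M. F (q x) = \<Phi> x"
    using homeomorphic_map_quotient_compact[OF M continuous_on_subset[OF cont W(2)] q]
    by (elim exE conjE)
  then have Fq: "F (q x) = \<Phi> x" if "x \<in> M" for x using that by simp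
  have F: "homeomorphic_map ?X (top_of_set ?S) F" using F0 unfolding \<Phi>_M .
  have top: "topspace ?X = q ` M"
    using quotient_imp_surjective_map[OF quotient_map_quotient_topology[of "top_of_set M" q]]
    by simp
  have FX: "F ` topspace ?X = ?S"
    using homeomorphic_imp_surjective_map[OF F] by simp
  have inj: "inj_on F (topspace ?X)"
    by (rule homeomorphic_imp_injective_map[OF F])
  define U where "U \<epsilon> = {a \<in> topspace ?X. F a $ 4 \<noteq> \<epsilon>}" for \<epsilon>
  define c where "c \<epsilon> = stereo \<epsilon> \<circ> F" for \<epsilon>
  define A where "A = (\<lambda>\<epsilon>. (U \<epsilon>, c \<epsilon>)) ` {1, -1 :: real}"
  have FU: "F ` U \<epsilon> = {y \<in> ?S. y $ 4 \<noteq> \<epsilon>}" for \<epsilon>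
    unfolding U_def FX[symmetric] by blast
  have openU: "openin ?X (U \<epsilon>)" for \<epsilon>
  proof -
    have "openin (top_of_set ?S) (?S \<inter> {y. y $ 4 \<noteq> \<epsilon>})"
      by (intro openin_open_Int open_Collect_neq continuous_intros)
    moreover have "U \<epsilon> = {a \<in> topspace ?X. F a \<in> ?S \<inter> {y. y $ 4 \<noteq> \<epsilon>}}"
      unfolding U_def FX[symmetric] by blast
    ultimately show ?thesis
      using homeomorphic_imp_continuous_map[OF F] by (simp only: openin_continuous_map_preimage)
  qed
  have chart: "homeomorphic_map (subtopology ?X (U \<epsilon>)) (top_of_set UNIV) (c \<epsilon>)"
    if "\<epsilon> \<in> {1, -1}" for \<epsilon>
  proof -
    have "homeomorphic_map (subtopology ?X (U \<epsilon>)) (subtopology (top_of_set ?S) {y \<in> ?S. y $ 4 \<noteq> \<epsilon>}) F"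
    proof (rule homeomorphic_map_subtopologies[OF F])
      have "topspace ?X \<inter> U \<epsilon> = U \<epsilon>" unfolding U_def by blast
      moreover have "topspace (top_of_set ?S) \<inter> {y \<in> ?S. y $ 4 \<noteq> \<epsilon>} = {y \<in> ?S. y $ 4 \<noteq> \<epsilon>}" by auto
      ultimately show "F ` (topspace ?X \<inter> U \<epsilon>) = topspace (top_of_set ?S) \<inter> {y \<in> ?S. y $ 4 \<noteq> \<epsilon>}"
        by (simp only: FU)
    qed
    moreover have "subtopology (top_of_set ?S) {y \<in> ?S. y $ 4 \<noteq> \<epsilon>} = top_of_set {y \<in> ?S. y $ 4 \<noteq> \<epsilon>}"
      by (simp add: subtopology_subtopology Int_def del: mem_sphere)
    ultimately have "homeomorphic_map (subtopology ?X (U \<epsilon>)) (top_of_set {y \<in> ?S. y $ 4 \<noteq> \<epsilon>}) F"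
      by (simp only:)
    then show ?thesis
      unfolding c_def by (rule homeomorphic_map_compose) (rule stereo_homeomorphic_map[OF that])
  qed
  have cU: "c \<epsilon> ` U \<epsilon> = UNIV" if "\<epsilon> \<in> {1, -1}" for \<epsilon>
    using homeomorphic_imp_surjective_map[OF chart[OF that]] openin_subset[OF openU[of \<epsilon>]]
    by (simp add: topspace_subtopology inf.absorb2)
  have inv_U: "inv_into (U \<epsilon>) (c \<epsilon>) x \<in> U \<epsilon>" and F_inv: "F (inv_into (U \<epsilon>) (c \<epsilon>) x) = stereo_inv \<epsilon> x"
    if "\<epsilon> \<in> {1, -1}" for \<epsilon> x
  proof -
    let ?a = "inv_into (U \<epsilon>) (c \<epsilon>) x"
    have x: "x \<in> c \<epsilon> ` U \<epsilon>" using cU[OF that] by simp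
    show a: "?a \<in> U \<epsilon>" by (rule inv_into_into[OF x])
    have "stereo \<epsilon> (F ?a) = x" using f_inv_into_f[OF x] by (simp add: c_def)
    moreover have "F ?a \<in> {y \<in> ?S. y $ 4 \<noteq> \<epsilon>}" using a FU by blast
    ultimately show "F ?a = stereo_inv \<epsilon> x" using stereo_inv_stereo[OF that, of "F ?a"] by auto
  qed
  have pole: "\<epsilon> * y $ 4 \<noteq> 1" if "\<epsilon> \<in> {1, -1}" "y $ 4 \<noteq> \<epsilon>" for \<epsilon> and y :: "real^4"
    using that by auto
  have transition: "smooth_on (c \<epsilon> ` (U \<epsilon> \<inter> U \<delta>)) (c \<delta> \<circ> inv_into (U \<epsilon>) (c \<epsilon>))"
    if \<epsilon>: "\<epsilon> \<in> {1, -1}" and \<delta>: "\<delta> \<in> {1, -1}" for \<epsilon> \<delta>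
  proof -
    \<comment> \<open>In chart coordinates the overlap is the set that
      \<open>stereo_inv \<epsilon>\<close> sends off the second pole; on it the transition map is
      \<open>stereo \<delta>\<close> after \<open>stereo_inv \<epsilon>\<close>.\<close>
    have dom: "c \<epsilon> ` (U \<epsilon> \<inter> U \<delta>) = {x. stereo_inv \<epsilon> x $ 4 \<noteq> \<delta>}"
    proof (intro equalityI subsetI)
      fix x assume "x \<in> c \<epsilon> ` (U \<epsilon> \<inter> U \<delta>)"
      then obtain a where a: "a \<in> U \<epsilon>" "a \<in> U \<delta>" "x = stereo \<epsilon> (F a)" by (auto simp: c_def)
      then have "F a \<in> ?S" "F a $ 4 \<noteq> \<epsilon>" "F a $ 4 \<noteq> \<delta>" using FU by blast+
      then show "x \<in> {x. stereo_inv \<epsilon> x $ 4 \<noteq> \<delta>}" using stereo_inv_stereo[OF \<epsilon>] a(3) by simp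
    next
      fix x assume "x \<in> {x. stereo_inv \<epsilon> x $ 4 \<noteq> \<delta>}"
      then have "inv_into (U \<epsilon>) (c \<epsilon>) x \<in> U \<epsilon> \<inter> U \<delta>"
        using inv_U[OF \<epsilon>, of x] F_inv[OF \<epsilon>, of x] by (simp add: U_def)
      moreover have "c \<epsilon> (inv_into (U \<epsilon>) (c \<epsilon>) x) = x"
        using F_inv[OF \<epsilon>, of x] stereo_stereo_inv[OF \<epsilon>] by (simp add: c_def)
      ultimately show "x \<in> c \<epsilon> ` (U \<epsilon> \<inter> U \<delta>)" by (metis imageI)
    qed
    have "open {x. stereo_inv \<epsilon> x $ 4 \<noteq> \<delta>}"
      by (intro open_Collect_neq continuous_on_const elementary_on_imp_continuous_on
          elementary_on_stereo_inv)
    moreover have "c \<delta> \<circ> inv_into (U \<epsilon>) (c \<epsilon>) = (\<lambda>x. stereo \<delta> (stereo_inv \<epsilon> x))"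
      using F_inv[OF \<epsilon>] by (auto simp: c_def)
    moreover have "elementary_on {x. stereo_inv \<epsilon> x $ 4 \<noteq> \<delta>} (\<lambda>x. stereo \<delta> (stereo_inv \<epsilon> x) $ i)" for i
      by (rule elementary_on_compose_vec[OF elementary_on_stereo[of "{y. y $ 4 \<noteq> \<delta>}"]])
        (use pole[OF \<delta>] elementary_on_stereo_inv in auto)
    ultimately show ?thesis unfolding dom by (simp add: smooth_on_elementary_vec)
  qed
  have manifold: "smooth_manifold ?X A"
    unfolding smooth_manifold_def
  proof (intro conjI)
    have homeo: "?X homeomorphic_space top_of_set ?S"
      by (rule homeomorphic_map_imp_homeomorphic_space[OF F])
    show "Hausdorff_space ?X"
      using homeomorphic_Hausdorff_space[OF homeo]
        Hausdorff_space_subtopology[OF Hausdorff_space_euclidean] by blast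
    show "second_countable ?X"
      unfolding homeomorphic_space_second_countability[OF homeo]
      by (intro second_countable_subtopology second_countable_euclidean)
    show "(\<Union>(V, d)\<in>A. V) = topspace ?X"
      by (auto simp: A_def U_def)
    show "\<forall>(V, d)\<in>A. openin ?X V \<and> open (d ` V) \<and>
        homeomorphic_map (subtopology ?X V) (top_of_set (d ` V)) d"
      using openU chart cU by (auto simp: A_def)
    show "\<forall>(V, d)\<in>A. \<forall>(V', d')\<in>A. smooth_on (d ` (V \<inter> V')) (d' \<circ> inv_into V d)"
      using transition[of 1 1] transition[of 1 "-1"] transition[of "-1" 1] transition[of "-1" "-1"]
      by (simp add: A_def)
  qed
  have cq: "(c \<epsilon> \<circ> q) x = stereo \<epsilon> (\<Phi> x)" if "x \<in> M" for \<epsilon> x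
    using Fq[OF that] by (simp add: c_def)
  have qU: "x \<in> M \<inter> q -` U \<epsilon> \<longleftrightarrow> x \<in> M \<and> \<Phi> x $ 4 \<noteq> \<epsilon>" for \<epsilon> x
    unfolding U_def top using Fq[of x] by auto
  have smooth_cq: "smooth_map (M \<inter> q -` U \<epsilon>) (c \<epsilon> \<circ> q)" if "\<epsilon> \<in> {1, -1}" for \<epsilon>
  proof (rule smooth_map_open)
    \<comment> \<open>On this open neighbourhood \<open>\<Phi>\<close> avoids the height of the
      pole, so the chart formula extends smoothly beyond \<open>M\<close>.\<close>
    let ?W = "W \<inter> \<Phi> -` {y. y $ 4 \<noteq> \<epsilon>}"
    show "open ?W"
      using cont W(1) by (intro continuous_open_preimage open_Collect_neq continuous_intros)
    show "M \<inter> q -` U \<epsilon> \<subseteq> ?W" using qU W(2) by blast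
    show "smooth_on ?W (\<lambda>x. stereo \<epsilon> (\<Phi> x))"
    proof (rule smooth_on_elementary_vec[OF \<open>open ?W\<close>])
      show "elementary_on ?W (\<lambda>x. stereo \<epsilon> (\<Phi> x) $ i)" for i
        by (rule elementary_on_compose_vec[OF elementary_on_stereo[of "{y. y $ 4 \<noteq> \<epsilon>}"]])
          (use pole[OF that] elementary_on_subset[OF \<Phi>] in auto)
    qed
    show "stereo \<epsilon> (\<Phi> x) = (c \<epsilon> \<circ> q) x" if "x \<in> M \<inter> q -` U \<epsilon>" for x
      using cq that by simp
  qed
  have submersion: "differential_range M (c \<epsilon> \<circ> q) p = UNIV"
    if \<epsilon>: "\<epsilon> \<in> {1, -1}" and p: "p \<in> M \<inter> q -` U \<epsilon>" for \<epsilon> p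
  proof -
    have pM: "p \<in> M" and p4: "\<Phi> p $ 4 \<noteq> \<epsilon>" using p qU by blast+
    obtain g where g: "\<forall>i. elementary_on UNIV (\<lambda>y. g y $ i)"
      "\<forall>y\<in>?S. g y \<in> M \<and> \<Phi> (g y) = y" "g (\<Phi> p) = p"
      using sections[OF pM] by (elim exE conjE)
    show ?thesis
    proof (rule stereo_curve[where \<epsilon> = \<epsilon> and \<Phi> = \<Phi> and g = g])
      show "\<Phi> p \<in> ?S" using pM \<Phi>_M by blast
      show "elementary_on UNIV (\<lambda>y. g y $ i)" for i using g(1) by (rule spec)
      show "g y \<in> M" "\<Phi> (g y) = y" if "y \<in> ?S" for y using bspec[OF g(2) that] by simp_all
    qed (fact \<epsilon> p4 g(3) cq)+
  qed
  have "quotient_manifold M q A"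
    unfolding quotient_manifold_def A_def[symmetric]
    using manifold smooth_cq submersion by (auto simp: A_def)
  moreover have "manifold_diffeomorphic ?X A ?S"
    unfolding manifold_diffeomorphic_def
  proof (intro exI[of _ F] conjI F)
    have "smooth_map (c \<epsilon> ` U \<epsilon>) (F \<circ> inv_into (U \<epsilon>) (c \<epsilon>))" if "\<epsilon> \<in> {1, -1}" for \<epsilon>
      by (rule smooth_map_open[of UNIV _ "stereo_inv \<epsilon>"])
        (auto simp: F_inv[OF that] intro!: smooth_on_elementary_vec elementary_on_stereo_inv)
    moreover have "smooth_map (F ` U \<epsilon>) (c \<epsilon> \<circ> inv_into (topspace ?X) F)" if "\<epsilon> \<in> {1, -1}" for \<epsilon>
    proof (rule smooth_map_open)
      show op: "open {y :: real^4. y $ 4 \<noteq> \<epsilon>}"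
        by (intro open_Collect_neq continuous_intros)
      show "F ` U \<epsilon> \<subseteq> {y :: real^4. y $ 4 \<noteq> \<epsilon>}" using FU by blast
      show "smooth_on {y :: real^4. y $ 4 \<noteq> \<epsilon>} (stereo \<epsilon>)"
        by (rule smooth_on_elementary_vec[OF op elementary_on_stereo]) (use pole[OF that] in auto)
      show "stereo \<epsilon> y = (c \<epsilon> \<circ> inv_into (topspace ?X) F) y" if "y \<in> F ` U \<epsilon>" for y
      proof -
        have "y \<in> F ` topspace ?X" using that by (auto simp: U_def)
        then show ?thesis by (simp add: c_def f_inv_into_f)
      qed
    qed
    ultimately show "\<forall>(V, d)\<in>A. smooth_map (d ` V) (F \<circ> inv_into V d) \<and>
        smooth_map (F ` V) (d \<circ> inv_into (topspace ?X) F)"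
      by (simp add: A_def)
  qed
  ultimately show ?thesis by blast
qed

section \<open>An explicit diffeomorphism onto the three-sphere\<close>

text \<open>For positive arguments this is the hyperbolic sine of half of
  \<open>ln (p / q)\<close>.\<close>

definition imbalance :: "real \<Rightarrow> real \<Rightarrow> real" where
  "imbalance p q = (p - q) / (2 * sqrt (p * q))"

text \<open>The matching hyperbolic cosine.\<close>

definition spread :: "real \<Rightarrow> real \<Rightarrow> real" where
  "spread p q = (p + q) / (2 * sqrt (p * q))"

lemma spread_pos: "p > 0 \<Longrightarrow> q > 0 \<Longrightarrow> spread p q > 0"
  by (simp add: spread_def)

lemma spread_square:
  assumes "p > 0" "q > 0"
  shows "(spread p q)\<^sup>2 = (p + q)\<^sup>2 / (4 * (p * q))" "(spread p q)\<^sup>2 = 1 + (imbalance p q)\<^sup>2"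
proof -
  show *: "(spread p q)\<^sup>2 = (p + q)\<^sup>2 / (4 * (p * q))"
    using assms by (simp add: spread_def power_divide power_mult_distrib)
  have "(imbalance p q)\<^sup>2 = (p - q)\<^sup>2 / (4 * (p * q))"
    using assms by (simp add: imbalance_def power_divide power_mult_distrib)
  then show "(spread p q)\<^sup>2 = 1 + (imbalance p q)\<^sup>2"
    unfolding * using assms by (simp add: field_simps power2_eq_square)
qed

lemma spread_eq: "p > 0 \<Longrightarrow> q > 0 \<Longrightarrow> spread p q = sqrt (1 + (imbalance p q)\<^sup>2)"
  using spread_square(2)[of p q] spread_pos[of p q] by (metis real_sqrt_unique less_imp_le)

lemma imbalance_eq: "p > 0 \<Longrightarrow> q > 0 \<Longrightarrow> p - q = (p + q) * (imbalance p q / spread p q)"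
  by (simp add: imbalance_def spread_def)

definition kappa :: "real \<Rightarrow> real \<Rightarrow> real \<Rightarrow> real \<Rightarrow> real" where
  "kappa p q r s = 4 * ((p + q) * (r + s))"

text \<open>When the arguments sum to 1, \<open>(p + q - r - s)\<^sup>2 = 1 - kappa p q r s\<close>.
  The extra factor turns the signed difference into a square root of
  \<open>1 / kappa\<^sup>2 - 1\<close> that stays smooth where the difference vanishes.\<close>

definition tilt :: "real \<Rightarrow> real \<Rightarrow> real \<Rightarrow> real \<Rightarrow> real" where
  "tilt p q r s = (p + q - r - s) * sqrt (1 + kappa p q r s) / kappa p q r s"

lemma kappa_pos: "p > 0 \<Longrightarrow> q > 0 \<Longrightarrow> r > 0 \<Longrightarrow> s > 0 \<Longrightarrow> kappa p q r s > 0"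
  by (simp add: kappa_def)

lemma tilt_square:
  assumes "p > 0" "q > 0" "r > 0" "s > 0" "p + q + r + s = 1"
  shows "1 + (tilt p q r s)\<^sup>2 = 1 / (kappa p q r s)\<^sup>2"
proof -
  let ?k = "kappa p q r s"
  have k: "?k > 0" using assms by (simp add: kappa_pos)
  have "(p + q - r - s)\<^sup>2 = (p + q + r + s)\<^sup>2 - ?k"
    by (simp add: kappa_def power2_eq_square algebra_simps)
  then have "(p + q - r - s)\<^sup>2 = 1 - ?k" using assms(5) by simp
  then have "(tilt p q r s)\<^sup>2 = (1 - ?k) * (1 + ?k) / ?k\<^sup>2"
    using k by (simp add: tilt_def power_divide power_mult_distrib)
  then show ?thesis using k by (simp add: field_simps power2_eq_square)
qed

text \<open>Each coordinate scales the next factor of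
  \<open>(1 + imbalance\<^sup>2) (1 + imbalance\<^sup>2) (1 + tilt\<^sup>2) (1 + (h/\<sigma>)\<^sup>2)\<close> by the product of the previous
  ones, so that this product becomes one plus the squared norm; on the level set it is constant.\<close>
definition invariants :: "real \<Rightarrow> real \<Rightarrow> real \<Rightarrow> real \<Rightarrow> real \<Rightarrow> real \<Rightarrow> real^4" where
  "invariants \<sigma> p q r s h = vector [imbalance p q, spread p q * imbalance r s,
     spread p q * spread r s * tilt p q r s,
     spread p q * spread r s * (h / \<sigma>) / kappa p q r s]"

lemma invariants_nth:
  "invariants \<sigma> p q r s h $ 1 = imbalance p q" "invariants \<sigma> p q r s h $ 2 = spread p q * imbalance r s"
  "invariants \<sigma> p q r s h $ 3 = spread p q * spread r s * tilt p q r s"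
  "invariants \<sigma> p q r s h $ 4 = spread p q * spread r s * (h / \<sigma>) / kappa p q r s"
  by (simp_all add: invariants_def vector_4)

lemma inner_vec4: "(y :: real^4) \<bullet> y = (y $ 1)\<^sup>2 + (y $ 2)\<^sup>2 + (y $ 3)\<^sup>2 + (y $ 4)\<^sup>2"
  by (simp add: inner_vec_def sum_4 power2_eq_square)

text \<open>The sum telescopes: \<open>spread_square\<close> absorbs the first two squares and
  \<open>tilt_square\<close> the third. The remaining factor is
  \<open>p * q * r * s / \<sigma>\<^sup>2\<close>, whose numerator cancels against the spreads and
  \<open>kappa\<close>.\<close>

lemma norm_invariants:
  assumes pos: "p > 0" "q > 0" "r > 0" "s > 0" and sum: "p + q + r + s = 1"
    and prod: "p * q * r * s = h\<^sup>2 + \<sigma>\<^sup>2" and "\<sigma> \<noteq> 0"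
  shows "1 + invariants \<sigma> p q r s h \<bullet> invariants \<sigma> p q r s h = 1 / (256 * \<sigma>\<^sup>2)"
proof -
  let ?a = "spread p q" and ?b = "spread r s" and ?k = "kappa p q r s"
  have "1 + invariants \<sigma> p q r s h \<bullet> invariants \<sigma> p q r s h =
      (1 + (imbalance p q)\<^sup>2) + ?a\<^sup>2 * (imbalance r s)\<^sup>2 + ?a\<^sup>2 * ?b\<^sup>2 * (tilt p q r s)\<^sup>2
      + ?a\<^sup>2 * ?b\<^sup>2 * (h / \<sigma>)\<^sup>2 * (1 / ?k\<^sup>2)"
    unfolding inner_vec4 invariants_nth power_divide power_mult_distrib by simp
  also have "\<dots> = ?a\<^sup>2 * (1 + (imbalance r s)\<^sup>2) + ?a\<^sup>2 * ?b\<^sup>2 * (tilt p q r s)\<^sup>2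
      + ?a\<^sup>2 * ?b\<^sup>2 * (h / \<sigma>)\<^sup>2 * (1 / ?k\<^sup>2)"
    unfolding spread_square(2)[OF pos(1,2), symmetric] by (simp add: algebra_simps)
  also have "\<dots> = ?a\<^sup>2 * ?b\<^sup>2 * (1 + (tilt p q r s)\<^sup>2)
      + ?a\<^sup>2 * ?b\<^sup>2 * (h / \<sigma>)\<^sup>2 * (1 / ?k\<^sup>2)"
    unfolding spread_square(2)[OF pos(3,4), symmetric] by (simp add: algebra_simps)
  also have "\<dots> = ?a\<^sup>2 * ?b\<^sup>2 * (1 / ?k\<^sup>2) * (1 + (h / \<sigma>)\<^sup>2)"
    unfolding tilt_square[OF pos sum] by (simp add: algebra_simps add_divide_distrib)
  also have "1 + (h / \<sigma>)\<^sup>2 = p * q * r * s / \<sigma>\<^sup>2"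
    unfolding prod using \<open>\<sigma> \<noteq> 0\<close> by (simp add: field_simps)
  also have "?a\<^sup>2 * ?b\<^sup>2 * (1 / ?k\<^sup>2) * (p * q * r * s / \<sigma>\<^sup>2) = 1 / (256 * \<sigma>\<^sup>2)"
  proof -
    have "p + q \<noteq> 0" "r + s \<noteq> 0" using pos by simp_all
    then show ?thesis
      unfolding spread_square(1)[OF pos(1,2)] spread_square(1)[OF pos(3,4)] kappa_def
      using pos \<open>\<sigma> \<noteq> 0\<close> by (simp add: power_mult_distrib)
  qed
  finally show ?thesis .
qed

text \<open>The system is triangular. The imbalances give the spreads, then the tilt;
  \<open>tilt_square\<close> gives the positive \<open>kappa\<close> and hence the difference of the
  pair sums. Total sum and imbalances yield the four moduli, and the last entry yields
  \<open>h\<close>.\<close>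

lemma invariants_inj:
  assumes pos: "p > 0" "q > 0" "r > 0" "s > 0" "p' > 0" "q' > 0" "r' > 0" "s' > 0"
    and sum: "p + q + r + s = 1" "p' + q' + r' + s' = 1" and "\<sigma> \<noteq> 0"
    and eq: "invariants \<sigma> p q r s h = invariants \<sigma> p' q' r' s' h'"
  shows "p = p'" "q = q'" "r = r'" "s = s'" "h = h'"
proof -
  note nth = eq[unfolded vec_eq_iff forall_4 invariants_nth]
  have imb_pq: "imbalance p q = imbalance p' q'" using nth by blast
  then have a: "spread p q = spread p' q'" using pos by (simp add: spread_eq)
  have "spread p q * imbalance r s = spread p q * imbalance r' s'" using nth a by metis
  then have imb_rs: "imbalance r s = imbalance r' s'" using spread_pos[OF pos(1,2)] by simp
  then have b: "spread r s = spread r' s'" using pos by (simp add: spread_eq)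
  have ab: "spread p q * spread r s \<noteq> 0" using spread_pos pos by (simp add: less_imp_neq[THEN not_sym])
  have "spread p q * spread r s * tilt p q r s = spread p q * spread r s * tilt p' q' r' s'"
    using nth a b by metis
  then have t: "tilt p q r s = tilt p' q' r' s'" using ab by simp
  have "1 / (kappa p q r s)\<^sup>2 = 1 / (kappa p' q' r' s')\<^sup>2"
    using tilt_square[OF pos(1-4) sum(1)] tilt_square[OF pos(5-8) sum(2)] t by metis
  then have "(kappa p q r s)\<^sup>2 = (kappa p' q' r' s')\<^sup>2" by simp
  then have k: "kappa p q r s = kappa p' q' r' s'"
    using kappa_pos[OF pos(1-4)] kappa_pos[OF pos(5-8)] by (simp add: power2_eq_iff_nonneg)
  have kp: "kappa p q r s > 0" by (rule kappa_pos[OF pos(1-4)])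
  have "(p + q - r - s) * sqrt (1 + kappa p q r s) = (p' + q' - r' - s') * sqrt (1 + kappa p q r s)"
    using t kp unfolding tilt_def k[symmetric] by simp
  moreover have "sqrt (1 + kappa p q r s) \<noteq> 0" using kp by simp
  ultimately have v: "p + q - r - s = p' + q' - r' - s'" by simp
  have pq: "p + q = p' + q'" and rs: "r + s = r' + s'" using v sum by linarith+
  have "p - q = p' - q'" "r - s = r' - s'"
    using imbalance_eq[OF pos(1,2)] imbalance_eq[OF pos(3,4)] imbalance_eq[OF pos(5,6)] imbalance_eq[OF pos(7,8)]
      imb_pq imb_rs a b pq rs by metis+
  then show "p = p'" "q = q'" "r = r'" "s = s'" using pq rs by linarith+
  have "spread p q * spread r s * (h / \<sigma>) / kappa p q r s = spread p q * spread r s * (h' / \<sigma>) / kappa p q r s"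
    using nth a b k by metis
  then show "h = h'" using ab kp \<open>\<sigma> \<noteq> 0\<close> by simp
qed

section \<open>The explicit inverse of the invariants\<close>

text \<open>The triangular system is solved in order: \<open>inv_a\<close> and \<open>inv_b\<close>
  are the two spreads, \<open>inv_B\<close> the second imbalance, \<open>inv_E\<close> the tilt,
  \<open>inv_e\<close> the reciprocal of \<open>kappa\<close>, and \<open>inv_v\<close> the
  difference of the pair sums.\<close>

definition inv_a :: "real^4 \<Rightarrow> real" where "inv_a y = sqrt (1 + (y $ 1)\<^sup>2)"
definition inv_B :: "real^4 \<Rightarrow> real" where "inv_B y = y $ 2 / inv_a y"
definition inv_b :: "real^4 \<Rightarrow> real" where "inv_b y = sqrt (1 + (inv_B y)\<^sup>2)"
definition inv_E :: "real^4 \<Rightarrow> real" where "inv_E y = y $ 3 / (inv_a y * inv_b y)"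
definition inv_e :: "real^4 \<Rightarrow> real" where "inv_e y = sqrt (1 + (inv_E y)\<^sup>2)"
text \<open>Putting \<open>kappa = 1 / inv_e\<close> into \<open>tilt\<close> gives
  \<open>inv_E = inv_v * sqrt (inv_e * (1 + inv_e))\<close>, which is solved for
  \<open>inv_v\<close>.\<close>

definition inv_v :: "real^4 \<Rightarrow> real" where "inv_v y = inv_E y / sqrt (inv_e y * (1 + inv_e y))"
definition inv_p :: "real^4 \<Rightarrow> real" where "inv_p y = (1 + inv_v y) / 4 * (1 + y $ 1 / inv_a y)"
definition inv_q :: "real^4 \<Rightarrow> real" where "inv_q y = (1 + inv_v y) / 4 * (1 - y $ 1 / inv_a y)"
definition inv_r :: "real^4 \<Rightarrow> real" where "inv_r y = (1 - inv_v y) / 4 * (1 + inv_B y / inv_b y)"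
definition inv_s :: "real^4 \<Rightarrow> real" where "inv_s y = (1 - inv_v y) / 4 * (1 - inv_B y / inv_b y)"
definition inv_h :: "real \<Rightarrow> real^4 \<Rightarrow> real" where
  "inv_h \<sigma> y = \<sigma> * y $ 4 / (inv_a y * inv_b y * inv_e y)"

lemma one_plus_square_pos: "1 + (x :: real)\<^sup>2 > 0"
  by (simp add: add_pos_nonneg)

lemma inv_pos: "inv_a y > 0" "inv_b y > 0" "inv_e y > 0"
  by (simp_all add: inv_a_def inv_b_def inv_e_def one_plus_square_pos)

lemma inv_square:
  "(inv_a y)\<^sup>2 = 1 + (y $ 1)\<^sup>2" "(inv_b y)\<^sup>2 = 1 + (inv_B y)\<^sup>2" "(inv_e y)\<^sup>2 = 1 + (inv_E y)\<^sup>2"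
  by (simp_all add: inv_a_def inv_b_def inv_e_def)

lemma inv_v_square: "(inv_v y)\<^sup>2 = 1 - 1 / inv_e y"
proof -
  let ?e = "inv_e y"
  have e: "?e > 0" by (rule inv_pos)
  then have "?e * (1 + ?e) > 0" by simp
  then have "(inv_v y)\<^sup>2 = (inv_E y)\<^sup>2 / (?e * (1 + ?e))"
    by (simp add: inv_v_def power_divide)
  also have "(inv_E y)\<^sup>2 = (?e - 1) * (1 + ?e)"
    using inv_square(3)[of y] by (simp add: power2_eq_square algebra_simps)
  also have "\<dots> / (?e * (1 + ?e)) = (?e - 1) / ?e"
    by (rule mult_divide_mult_cancel_right) (use e in simp)
  finally show ?thesis using e by (simp add: field_simps)
qed

text \<open>With \<open>a\<close> and \<open>x\<close> as hyperbolic cosine and sine, these are the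
  bound on the hyperbolic tangent and \<open>1 - tanh\<^sup>2 = 1 / cosh\<^sup>2\<close>.\<close>

lemma abs_less_1_fraction:
  fixes x a :: real
  assumes "a\<^sup>2 = 1 + x\<^sup>2" "a > 0"
  shows "\<bar>x / a\<bar> < 1" "(1 + x / a) * (1 - x / a) = 1 / a\<^sup>2"
proof -
  have "\<bar>x\<bar>\<^sup>2 < a\<^sup>2" using assms(1) by simp
  then have "\<bar>x\<bar> < a" using assms(2) by (intro power2_less_imp_less[of "\<bar>x\<bar>" a]) simp_all
  then show "\<bar>x / a\<bar> < 1" using assms(2) by simp
  have "(1 + x / a) * (1 - x / a) = (a\<^sup>2 - x\<^sup>2) / a\<^sup>2"
    using assms(2) by (simp add: field_simps power2_eq_square)
  then show "(1 + x / a) * (1 - x / a) = 1 / a\<^sup>2" using assms(1) by simp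
qed

lemma inv_v_bound: "\<bar>inv_v y\<bar> < 1"
proof -
  have "(inv_v y)\<^sup>2 < 1" using inv_v_square[of y] inv_pos(3)[of y] by simp
  then show ?thesis by (simp add: abs_square_less_1)
qed

lemma inv_moduli_pos: "inv_p y > 0" "inv_q y > 0" "inv_r y > 0" "inv_s y > 0"
proof -
  have *: "c / 4 * (1 + t) > 0" "c / 4 * (1 - t) > 0" if "c > 0" "\<bar>t\<bar> < 1" for c t :: real
    using that by (auto simp: abs_less_iff intro!: mult_pos_pos)
  have v: "1 + inv_v y > 0" "1 - inv_v y > 0" using inv_v_bound[of y] by auto
  note frac = abs_less_1_fraction(1)[OF inv_square(1) inv_pos(1), of y]
    abs_less_1_fraction(1)[OF inv_square(2) inv_pos(2), of y]
  show "inv_p y > 0" "inv_q y > 0" "inv_r y > 0" "inv_s y > 0"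
    unfolding inv_p_def inv_q_def inv_r_def inv_s_def by (intro * v frac)+
qed

lemma inv_moduli_sum:
  "inv_p y + inv_q y = (1 + inv_v y) / 2" "inv_r y + inv_s y = (1 - inv_v y) / 2"
  "inv_p y + inv_q y + inv_r y + inv_s y = 1"
  by (simp_all add: inv_p_def inv_q_def inv_r_def inv_s_def field_simps)

lemma inv_moduli_prod:
  "inv_p y * inv_q y = ((1 + inv_v y) / (4 * inv_a y))\<^sup>2"
  "inv_r y * inv_s y = ((1 - inv_v y) / (4 * inv_b y))\<^sup>2"
proof -
  have *: "c / 4 * t * (c / 4 * u) = (c / (4 * a))\<^sup>2" if "t * u = 1 / a\<^sup>2" for c t u a :: real
  proof -
    have "c / 4 * t * (c / 4 * u) = (c / 4)\<^sup>2 * (t * u)" by (simp add: power2_eq_square)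
    then show ?thesis unfolding that by (simp add: power_divide power_mult_distrib)
  qed
  show "inv_p y * inv_q y = ((1 + inv_v y) / (4 * inv_a y))\<^sup>2"
    unfolding inv_p_def inv_q_def
    by (rule *) (rule abs_less_1_fraction(2)[OF inv_square(1) inv_pos(1)])
  show "inv_r y * inv_s y = ((1 - inv_v y) / (4 * inv_b y))\<^sup>2"
    unfolding inv_r_def inv_s_def
    by (rule *) (rule abs_less_1_fraction(2)[OF inv_square(2) inv_pos(2)])
qed

lemma kappa_inv: "kappa (inv_p y) (inv_q y) (inv_r y) (inv_s y) = 1 / inv_e y"
proof -
  have "kappa (inv_p y) (inv_q y) (inv_r y) (inv_s y) = (1 + inv_v y) * (1 - inv_v y)"
    by (simp add: kappa_def inv_moduli_sum(1,2))
  also have "\<dots> = 1 - (inv_v y)\<^sup>2" by (simp add: power2_eq_square algebra_simps)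
  finally have "kappa (inv_p y) (inv_q y) (inv_r y) (inv_s y) = 1 - (inv_v y)\<^sup>2" .
  then show ?thesis by (simp add: inv_v_square)
qed

text \<open>The products of the two pairs are perfect squares of positive numbers, so the roots in
  the imbalances resolve and the invariants can be evaluated one after the other.\<close>

lemma invariants_inv:
  assumes "\<sigma> \<noteq> 0"
  shows "invariants \<sigma> (inv_p y) (inv_q y) (inv_r y) (inv_s y) (inv_h \<sigma> y) = y"
proof -
  have v: "1 + inv_v y > 0" "1 - inv_v y > 0" using inv_v_bound[of y] by auto
  note pos = inv_pos[of y]
  have sq1: "sqrt (inv_p y * inv_q y) = (1 + inv_v y) / (4 * inv_a y)"
    unfolding inv_moduli_prod using v pos by simp
  have sq2: "sqrt (inv_r y * inv_s y) = (1 - inv_v y) / (4 * inv_b y)"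
    unfolding inv_moduli_prod using v pos by simp
  have diff: "c / 4 * (1 + t) - c / 4 * (1 - t) = c / 2 * t" for c t :: real
    by (simp add: field_simps)
  have quot: "c / 2 * (t / a) / (2 * (c / (4 * a))) = t" if "c > 0" "a > 0" for c t a :: real
    using that by (simp add: field_simps)
  have pq: "inv_p y - inv_q y = (1 + inv_v y) / 2 * (y $ 1 / inv_a y)"
    unfolding inv_p_def inv_q_def by (rule diff)
  have imb_pq: "imbalance (inv_p y) (inv_q y) = y $ 1"
    unfolding imbalance_def sq1 pq by (intro quot v pos)
  have rs: "inv_r y - inv_s y = (1 - inv_v y) / 2 * (inv_B y / inv_b y)"
    unfolding inv_r_def inv_s_def by (rule diff)
  have imb_rs: "imbalance (inv_r y) (inv_s y) = inv_B y"
    unfolding imbalance_def sq2 rs by (intro quot v pos)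
  have a: "spread (inv_p y) (inv_q y) = inv_a y"
    unfolding spread_eq[OF inv_moduli_pos(1,2)] imb_pq by (simp add: inv_a_def)
  have b: "spread (inv_r y) (inv_s y) = inv_b y"
    unfolding spread_eq[OF inv_moduli_pos(3,4)] imb_rs by (simp add: inv_b_def)
  have t: "tilt (inv_p y) (inv_q y) (inv_r y) (inv_s y) = inv_E y"
  proof -
    let ?e = "inv_e y"
    have "inv_p y + inv_q y - inv_r y - inv_s y = inv_v y"
      using inv_moduli_sum(1,2)[of y] by (simp add: field_simps)
    \<comment> \<open>With the denominator \<open>?e\<^sup>2\<close>, the root in
      \<open>tilt\<close> splits off exactly the denominator of \<open>inv_v\<close>.\<close>
    moreover have "1 + 1 / ?e = ?e * (1 + ?e) / ?e\<^sup>2"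
      using pos(3) by (simp add: field_simps power2_eq_square)
    then have "sqrt (1 + 1 / ?e) = sqrt (?e * (1 + ?e)) / ?e"
      using pos(3) by (simp add: real_sqrt_divide)
    moreover have "sqrt (?e * (1 + ?e)) \<noteq> 0" using pos(3) by simp
    ultimately show ?thesis
      unfolding tilt_def kappa_inv using pos(3) by (simp add: inv_v_def)
  qed
  show ?thesis
    unfolding vec_eq_iff forall_4 invariants_nth imb_pq imb_rs a b t kappa_inv
    using pos assms by (simp add: inv_B_def inv_E_def inv_h_def)
qed

text \<open>The telescoping of \<open>norm_invariants\<close> in reverse: with
  \<open>N = (inv_a y * inv_b y * inv_e y)\<^sup>2\<close>, the norm condition reads
  \<open>N + (y $ 4)\<^sup>2 = 1 / (256 * \<sigma>\<^sup>2)\<close>, while the product of the moduli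
  is \<open>1 / (256 * N)\<close>.\<close>

lemma inv_on_level:
  assumes "1 + y \<bullet> y = 1 / (256 * \<sigma>\<^sup>2)" "\<sigma> \<noteq> 0"
  shows "inv_p y * inv_q y * inv_r y * inv_s y = (inv_h \<sigma> y)\<^sup>2 + \<sigma>\<^sup>2"
proof -
  let ?a = "inv_a y" and ?b = "inv_b y" and ?e = "inv_e y"
  note pos = inv_pos[of y]
  have "(1 + inv_v y) * (1 - inv_v y) = 1 / ?e"
    using inv_v_square[of y] by (simp add: power2_eq_square algebra_simps)
  then have "inv_p y * inv_q y * (inv_r y * inv_s y) = (1 / ?e / (16 * (?a * ?b)))\<^sup>2"
    unfolding inv_moduli_prod by (simp add: power_mult_distrib[symmetric] mult_ac)
  then have l: "inv_p y * inv_q y * inv_r y * inv_s y = 1 / (256 * (?a * ?b * ?e)\<^sup>2)"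
    by (simp add: power_divide power_mult_distrib mult_ac)
  have "1 + y \<bullet> y = ?a\<^sup>2 + (y $ 2)\<^sup>2 + (y $ 3)\<^sup>2 + (y $ 4)\<^sup>2"
    by (simp add: inner_vec4 inv_square)
  also have "(y $ 2)\<^sup>2 = ?a\<^sup>2 * (inv_B y)\<^sup>2"
    using pos by (simp add: inv_B_def power_divide)
  also have "(y $ 3)\<^sup>2 = ?a\<^sup>2 * ?b\<^sup>2 * (inv_E y)\<^sup>2"
    using pos by (simp add: inv_E_def power_divide power_mult_distrib)
  also have "?a\<^sup>2 + ?a\<^sup>2 * (inv_B y)\<^sup>2 + ?a\<^sup>2 * ?b\<^sup>2 * (inv_E y)\<^sup>2 = (?a * ?b * ?e)\<^sup>2"
    by (simp add: power_mult_distrib inv_square algebra_simps)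
  finally have "(?a * ?b * ?e)\<^sup>2 + (y $ 4)\<^sup>2 = 1 / (256 * \<sigma>\<^sup>2)" using assms(1) by simp
  then have N: "\<sigma>\<^sup>2 * ((?a * ?b * ?e)\<^sup>2 + (y $ 4)\<^sup>2) = 1 / 256"
    using assms(2) by simp
  have "(inv_h \<sigma> y)\<^sup>2 + \<sigma>\<^sup>2 =
      \<sigma>\<^sup>2 * ((?a * ?b * ?e)\<^sup>2 + (y $ 4)\<^sup>2) / (?a * ?b * ?e)\<^sup>2"
    using pos by (simp add: inv_h_def power_divide power_mult_distrib field_simps)
  then show ?thesis unfolding l N by simp
qed

lemma elementary_on_inv:
  "elementary_on U inv_p" "elementary_on U inv_q" "elementary_on U inv_r" "elementary_on U inv_s"
  "elementary_on U (inv_h \<sigma>)"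
proof -
  note nz = less_imp_neq[THEN not_sym]
  have a: "elementary_on U inv_a"
    unfolding inv_a_def[abs_def] by (intro elementary_on_intros) (simp add: one_plus_square_pos)
  have B: "elementary_on U inv_B"
    unfolding inv_B_def[abs_def] by (intro elementary_on_intros a) (simp add: inv_pos nz)
  have b: "elementary_on U inv_b"
    unfolding inv_b_def[abs_def] by (intro elementary_on_intros B) (simp add: one_plus_square_pos)
  have E: "elementary_on U inv_E"
    unfolding inv_E_def[abs_def] by (intro elementary_on_intros a b) (simp add: inv_pos nz)
  have e: "elementary_on U inv_e"
    unfolding inv_e_def[abs_def] by (intro elementary_on_intros E) (simp add: one_plus_square_pos)
  have pos: "inv_e y * (1 + inv_e y) > 0" for y using inv_pos(3)[of y] by simp
  then have "sqrt (inv_e y * (1 + inv_e y)) \<noteq> 0" for y using nz real_sqrt_gt_zero by blast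
  with pos have v: "elementary_on U inv_v"
    unfolding inv_v_def[abs_def] by (intro elementary_on_intros E e)
  note intros = elementary_on_intros a B b v e
  show "elementary_on U inv_p"
    unfolding inv_p_def[abs_def] by (intro intros) (simp_all add: inv_pos nz)
  show "elementary_on U inv_q"
    unfolding inv_q_def[abs_def] by (intro intros) (simp_all add: inv_pos nz)
  show "elementary_on U inv_r"
    unfolding inv_r_def[abs_def] by (intro intros) (simp_all add: inv_pos nz)
  show "elementary_on U inv_s"
    unfolding inv_s_def[abs_def] by (intro intros) (simp_all add: inv_pos nz)
  show "elementary_on U (inv_h \<sigma>)"
    unfolding inv_h_def[abs_def] by (intro intros) (simp_all add: inv_pos nz)
qed

section \<open>Regular level sets\<close>

text \<open>By \<open>norm_invariants\<close> the invariants of a level set lie on the sphere of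
  this radius. Here \<open>\<sigma>\<close> is the imaginary part of \<open>z_prod\<close>, a
  quarter of the level.\<close>

definition radius :: "real \<Rightarrow> real" where
  "radius \<sigma> = sqrt (1 / (256 * \<sigma>\<^sup>2) - 1)"

definition orbit_map :: "real \<Rightarrow> real^8 \<Rightarrow> real^4" where
  "orbit_map \<sigma> x = (1 / radius \<sigma>) *\<^sub>R invariants \<sigma> ((cmod (z1 x))\<^sup>2) ((cmod (z2 x))\<^sup>2)
     ((cmod (z3 x))\<^sup>2) ((cmod (z4 x))\<^sup>2) (Re (z_prod x))"

text \<open>The first three coordinates are positive reals and the whole phase sits in the fourth,
  scaled so that the product becomes \<open>Complex (inv_h \<sigma> y) \<sigma>\<close> on the
  relevant sphere.\<close>

definition orbit_section :: "real \<Rightarrow> real^4 \<Rightarrow> real^8" where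
  "orbit_section \<sigma> y = of_z (sqrt (inv_p y)) (sqrt (inv_q y)) (sqrt (inv_r y))
     (Complex (inv_h \<sigma> y / sqrt (inv_p y * inv_q y * inv_r y)) (\<sigma> / sqrt (inv_p y * inv_q y * inv_r y)))"

lemma level_set_iff: "x \<in> level_set s \<longleftrightarrow> x \<in> S7 \<and> Im (z_prod x) = s / 4"
  by (auto simp: level_set_def nu_eq_z_prod)

lemma cmod_z_prod: "(cmod (z1 x))\<^sup>2 * (cmod (z2 x))\<^sup>2 * (cmod (z3 x))\<^sup>2 * (cmod (z4 x))\<^sup>2 =
    (Re (z_prod x))\<^sup>2 + (Im (z_prod x))\<^sup>2"
  unfolding cmod_power2[symmetric] by (simp add: z_prod_def norm_mult power_mult_distrib)

lemma level_set_moduli_pos: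
  assumes "x \<in> level_set s" "s \<noteq> 0"
  shows "(cmod (z1 x))\<^sup>2 > 0" "(cmod (z2 x))\<^sup>2 > 0" "(cmod (z3 x))\<^sup>2 > 0" "(cmod (z4 x))\<^sup>2 > 0"
proof -
  have "z_prod x \<noteq> 0" using assms by (auto simp: level_set_iff)
  then show "(cmod (z1 x))\<^sup>2 > 0" "(cmod (z2 x))\<^sup>2 > 0" "(cmod (z3 x))\<^sup>2 > 0" "(cmod (z4 x))\<^sup>2 > 0"
    by (auto simp: z_prod_def)
qed

lemma radius_pos:
  assumes "\<sigma> \<noteq> 0" "\<bar>\<sigma>\<bar> < 1/16"
  shows "radius \<sigma> > 0" "(radius \<sigma>)\<^sup>2 = 1 / (256 * \<sigma>\<^sup>2) - 1"
proof -
  have "\<bar>\<sigma>\<bar>\<^sup>2 < (1/16)\<^sup>2" by (rule power_strict_mono) (use assms in auto)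
  then have "256 * \<sigma>\<^sup>2 < 1" by (simp add: power_divide)
  moreover have "\<sigma>\<^sup>2 > 0" using assms(1) by simp
  ultimately have "1 / (256 * \<sigma>\<^sup>2) > 1" by simp
  then show "radius \<sigma> > 0" "(radius \<sigma>)\<^sup>2 = 1 / (256 * \<sigma>\<^sup>2) - 1" by (simp_all add: radius_def)
qed

lemma orbit_map_in_sphere:
  assumes "x \<in> level_set (4 * \<sigma>)" "\<sigma> \<noteq> 0" "\<bar>\<sigma>\<bar> < 1/16"
  shows "orbit_map \<sigma> x \<in> sphere 0 1"
proof -
  let ?Y = "invariants \<sigma> ((cmod (z1 x))\<^sup>2) ((cmod (z2 x))\<^sup>2) ((cmod (z3 x))\<^sup>2) ((cmod (z4 x))\<^sup>2)
    (Re (z_prod x))"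
  have "1 + ?Y \<bullet> ?Y = 1 / (256 * \<sigma>\<^sup>2)"
    using assms level_set_moduli_pos[OF assms(1)]
    by (intro norm_invariants) (simp_all add: level_set_iff S7_iff cmod_z_prod)
  then have "?Y \<bullet> ?Y = (radius \<sigma>)\<^sup>2" using radius_pos(2)[OF assms(2,3)] by simp
  then have "orbit_map \<sigma> x \<bullet> orbit_map \<sigma> x = 1"
    using radius_pos(1)[OF assms(2,3)] by (simp add: orbit_map_def power2_eq_square)
  then show ?thesis by (simp add: norm_eq_1)
qed

text \<open>By \<open>invariants_inj\<close>, equal images have equal moduli and equal real parts of
  the product; the imaginary part is fixed by the level.\<close>

lemma T3_orbit_eq_iff_orbit_map:
  assumes "x \<in> level_set (4 * \<sigma>)" "y \<in> level_set (4 * \<sigma>)" and \<sigma>: "\<sigma> \<noteq> 0" "\<bar>\<sigma>\<bar> < 1/16"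
  shows "T3_orbit x = T3_orbit y \<longleftrightarrow> orbit_map \<sigma> x = orbit_map \<sigma> y"
proof
  assume "orbit_map \<sigma> x = orbit_map \<sigma> y"
  then have eq: "invariants \<sigma> ((cmod (z1 x))\<^sup>2) ((cmod (z2 x))\<^sup>2) ((cmod (z3 x))\<^sup>2)
      ((cmod (z4 x))\<^sup>2) (Re (z_prod x)) = invariants \<sigma> ((cmod (z1 y))\<^sup>2) ((cmod (z2 y))\<^sup>2)
      ((cmod (z3 y))\<^sup>2) ((cmod (z4 y))\<^sup>2) (Re (z_prod y))"
    using radius_pos(1)[OF \<sigma>] by (simp add: orbit_map_def)
  have s: "4 * \<sigma> \<noteq> 0" using \<sigma> by simp
  have sum: "(cmod (z1 u))\<^sup>2 + (cmod (z2 u))\<^sup>2 + (cmod (z3 u))\<^sup>2 + (cmod (z4 u))\<^sup>2 = 1"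
    if "u \<in> level_set (4 * \<sigma>)" for u
    using that by (simp add: level_set_iff S7_iff)
  note inj = invariants_inj[OF level_set_moduli_pos[OF assms(1) s]
      level_set_moduli_pos[OF assms(2) s] sum[OF assms(1)] sum[OF assms(2)] \<sigma>(1) eq]
  have "z_prod x = z_prod y"
    using inj(5) assms(1,2) by (simp add: complex_eq_iff level_set_iff)
  then show "T3_orbit x = T3_orbit y"
    unfolding T3_orbit_eq_iff using inj(1-4) by (simp add: power2_eq_iff_nonneg)
next
  assume "T3_orbit x = T3_orbit y"
  then show "orbit_map \<sigma> x = orbit_map \<sigma> y"
    unfolding T3_orbit_eq_iff by (simp only: orbit_map_def)
qed

lemma orbit_section:
  fixes y :: "real^4"
  assumes y: "y \<in> sphere 0 1" and \<sigma>: "\<sigma> \<noteq> 0" "\<bar>\<sigma>\<bar> < 1/16"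
  shows "orbit_section \<sigma> (radius \<sigma> *\<^sub>R y) \<in> level_set (4 * \<sigma>)"
    and "orbit_map \<sigma> (orbit_section \<sigma> (radius \<sigma> *\<^sub>R y)) = y"
proof -
  define Y where "Y = radius \<sigma> *\<^sub>R y"
  define p q r s h where pqrs: "p = inv_p Y" "q = inv_q Y" "r = inv_r Y" "s = inv_s Y"
    "h = inv_h \<sigma> Y"
  let ?x = "orbit_section \<sigma> Y" and ?d = "sqrt (p * q * r)"
  have pos: "p > 0" "q > 0" "r > 0" "s > 0" by (simp_all add: pqrs inv_moduli_pos)
  have "Y \<bullet> Y = (radius \<sigma>)\<^sup>2 * (y \<bullet> y)" by (simp add: Y_def power2_eq_square)
  then have "1 + Y \<bullet> Y = 1 / (256 * \<sigma>\<^sup>2)"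
    using y radius_pos(2)[OF \<sigma>] by (simp add: norm_eq_1)
  then have prod: "p * q * r * s = h\<^sup>2 + \<sigma>\<^sup>2"
    unfolding pqrs using \<sigma>(1) by (rule inv_on_level)
  have d: "?d > 0" "?d\<^sup>2 = p * q * r" using pos by simp_all
  have z: "z1 ?x = sqrt p" "z2 ?x = sqrt q" "z3 ?x = sqrt r" "z4 ?x = Complex (h / ?d) (\<sigma> / ?d)"
    by (simp_all add: orbit_section_def pqrs)
  \<comment> \<open>By \<open>prod\<close> the numerator equals \<open>p * q * r * s\<close>, so the
    fourth squared modulus comes out as \<open>s\<close>.\<close>
  have "(cmod (z4 ?x))\<^sup>2 = (h\<^sup>2 + \<sigma>\<^sup>2) / (p * q * r)"
    unfolding z cmod_power2 complex.sel power_divide d(2) by (simp add: add_divide_distrib)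
  then have m4: "(cmod (z4 ?x))\<^sup>2 = s" unfolding prod[symmetric] using pos by simp
  have m: "(cmod (z1 ?x))\<^sup>2 = p" "(cmod (z2 ?x))\<^sup>2 = q" "(cmod (z3 ?x))\<^sup>2 = r"
    using pos by (simp_all add: z)
  have "z1 ?x * z2 ?x * z3 ?x = of_real ?d"
    by (simp add: z real_sqrt_mult)
  then have "z_prod ?x = of_real ?d * Complex (h / ?d) (\<sigma> / ?d)"
    by (simp add: z_prod_def z(4))
  then have P: "z_prod ?x = Complex h \<sigma>"
    using d(1) pos by (simp add: complex_eq_iff)
  have "p + q + r + s = 1" by (simp add: pqrs inv_moduli_sum(3))
  then have "?x \<in> level_set (4 * \<sigma>)"
    unfolding level_set_iff S7_iff m m4 P by simp
  then show "orbit_section \<sigma> (radius \<sigma> *\<^sub>R y) \<in> level_set (4 * \<sigma>)" by (simp add: Y_def)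
  have "orbit_map \<sigma> ?x = (1 / radius \<sigma>) *\<^sub>R Y"
    unfolding orbit_map_def m m4 P complex.sel pqrs invariants_inv[OF \<sigma>(1)] ..
  then show "orbit_map \<sigma> (orbit_section \<sigma> (radius \<sigma> *\<^sub>R y)) = y"
    using radius_pos(1)[OF \<sigma>] by (simp add: Y_def)
qed

lemma celementary_on_z_orbit_section:
  "celementary_on U (\<lambda>y. z1 (orbit_section \<sigma> (k *\<^sub>R y)))"
  "celementary_on U (\<lambda>y. z2 (orbit_section \<sigma> (k *\<^sub>R y)))"
  "celementary_on U (\<lambda>y. z3 (orbit_section \<sigma> (k *\<^sub>R y)))"
  "celementary_on U (\<lambda>y. z4 (orbit_section \<sigma> (k *\<^sub>R y)))"
proof -
  have scale: "elementary_on U (\<lambda>y. f (k *\<^sub>R y))" if "elementary_on UNIV f" for f :: "real^4 \<Rightarrow> real"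
    using that by (rule elementary_on_compose_vec) (auto intro: elementary_on_intros)
  note inv = elementary_on_inv[THEN scale]
  have pos: "inv_p y * inv_q y * inv_r y > 0" for y by (simp add: inv_moduli_pos)
  then have nz: "sqrt (inv_p y * inv_q y * inv_r y) \<noteq> 0" for y
    by (metis less_irrefl real_sqrt_gt_zero)
  show "celementary_on U (\<lambda>y. z1 (orbit_section \<sigma> (k *\<^sub>R y)))"
    "celementary_on U (\<lambda>y. z2 (orbit_section \<sigma> (k *\<^sub>R y)))"
    "celementary_on U (\<lambda>y. z3 (orbit_section \<sigma> (k *\<^sub>R y)))"
    "celementary_on U (\<lambda>y. z4 (orbit_section \<sigma> (k *\<^sub>R y)))"
    unfolding orbit_section_def z_of_z celementary_on_def complex.sel Re_complex_of_real
      Im_complex_of_real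
    by (intro conjI elementary_on_intros inv pos nz inv_moduli_pos)+
qed

text \<open>The global section meets the orbit of \<open>p\<close>, possibly at another point.
  Rotating it by the torus element that carries this point to \<open>p\<close> corrects that and
  leaves all orbits, hence \<open>orbit_map\<close>, unchanged.\<close>

lemma orbit_section_through:
  assumes p: "p \<in> level_set (4 * \<sigma>)" and \<sigma>: "\<sigma> \<noteq> 0" "\<bar>\<sigma>\<bar> < 1/16"
  shows "\<exists>g. (\<forall>i. elementary_on UNIV (\<lambda>y. g y $ i)) \<and>
      (\<forall>y\<in>sphere 0 1. g y \<in> level_set (4 * \<sigma>) \<and> orbit_map \<sigma> (g y) = y) \<and>
      g (orbit_map \<sigma> p) = p"
proof -
  let ?s = "\<lambda>y. orbit_section \<sigma> (radius \<sigma> *\<^sub>R y)"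
  let ?y = "orbit_map \<sigma> p"
  have y: "?y \<in> sphere 0 1" by (rule orbit_map_in_sphere[OF p \<sigma>])
  have "T3_orbit p = T3_orbit (?s ?y)"
    using T3_orbit_eq_iff_orbit_map[OF p orbit_section(1)[OF y \<sigma>] \<sigma>] orbit_section(2)[OF y \<sigma>]
    by simp
  then have "p \<in> T3_orbit (?s ?y)" unfolding T3_orbit_eq_iff mem_T3_orbit_iff .
  then obtain a b c where p_eq: "z1 p = cis (- a) * z1 (?s ?y)" "z2 p = cis (- b) * z2 (?s ?y)"
      "z3 p = cis c * z3 (?s ?y)" "z4 p = cis (a + b - c) * z4 (?s ?y)"
    unfolding T3_orbit_iff by blast
  define g where "g y = of_z (cis (- a) * z1 (?s y)) (cis (- b) * z2 (?s y)) (cis c * z3 (?s y))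
    (cis (a + b - c) * z4 (?s y))" for y
  have orbit: "T3_orbit (g y) = T3_orbit (?s y)" for y
  proof -
    have "g y \<in> T3_orbit (?s y)" unfolding T3_orbit_iff g_def z_of_z by blast
    then show ?thesis unfolding T3_orbit_eq_iff mem_T3_orbit_iff .
  qed
  show ?thesis
  proof (intro exI[of _ g] conjI allI ballI)
    show "elementary_on UNIV (\<lambda>y. g y $ i)" for i
      unfolding g_def
      by (intro elementary_on_of_z celementary_on_mult celementary_on_const
          celementary_on_z_orbit_section)
    show "g ?y = p" by (rule z_eqI) (simp_all add: g_def p_eq)
    fix y :: "real^4" assume y: "y \<in> sphere 0 1"
    show gy: "g y \<in> level_set (4 * \<sigma>)"
      using orbit_section(1)[OF y \<sigma>] orbit[of y] unfolding T3_orbit_eq_iff level_set_iff S7_iff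
      by simp
    show "orbit_map \<sigma> (g y) = y"
      using T3_orbit_eq_iff_orbit_map[OF gy orbit_section(1)[OF y \<sigma>] \<sigma>] orbit[of y]
        orbit_section(2)[OF y \<sigma>] by simp
  qed
qed

lemma compact_level_set: "compact (level_set s)"
proof -
  have "closed {x. Im (z_prod x) = s / 4}"
    unfolding z_prod_def by (intro closed_Collect_eq continuous_intros)
  moreover have "level_set s = S7 \<inter> {x. Im (z_prod x) = s / 4}"
    by (auto simp: level_set_iff)
  ultimately show ?thesis using compact_S7 by (simp add: compact_Int_closed)
qed

text \<open>Where the product is non-zero all four squared moduli are positive, which keeps the
  roots and denominators of the invariants away from zero.\<close>

lemma elementary_on_orbit_map:
  assumes "\<And>x. x \<in> U \<Longrightarrow> z_prod x \<noteq> 0" "\<sigma> \<noteq> 0"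
  shows "elementary_on U (\<lambda>x. orbit_map \<sigma> x $ i)"
proof -
  \<comment> \<open>The squared modulus is a polynomial in the real and imaginary parts, unlike the
    modulus itself.\<close>
  have sq: "elementary_on U (\<lambda>x. (cmod (f x))\<^sup>2)" if "celementary_on U f" for f
    using that unfolding celementary_on_def cmod_power2 by (intro elementary_on_intros) simp_all
  note m = celementary_on_z[THEN sq]
  have h: "elementary_on U (\<lambda>x. Re (z_prod x))"
    using celementary_on_mult[OF celementary_on_mult[OF celementary_on_mult[OF
        celementary_on_z(1) celementary_on_z(2)] celementary_on_z(3)] celementary_on_z(4)]
    by (simp add: z_prod_def celementary_on_def)
  have pos: "(cmod (z1 x))\<^sup>2 > 0" "(cmod (z2 x))\<^sup>2 > 0" "(cmod (z3 x))\<^sup>2 > 0" "(cmod (z4 x))\<^sup>2 > 0"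
    if "x \<in> U" for x
    using assms(1)[OF that] by (auto simp: z_prod_def)
  have bin: "elementary_on U (\<lambda>x. imbalance (f x) (g x))" "elementary_on U (\<lambda>x. spread (f x) (g x))"
    if "elementary_on U f" "elementary_on U g" "\<And>x. x \<in> U \<Longrightarrow> f x > 0" "\<And>x. x \<in> U \<Longrightarrow> g x > 0"
    for f g
  proof -
    have prod: "f x * g x > 0" "2 * sqrt (f x * g x) \<noteq> 0" if "x \<in> U" for x
      using \<open>\<And>x. x \<in> U \<Longrightarrow> f x > 0\<close>[OF that] \<open>\<And>x. x \<in> U \<Longrightarrow> g x > 0\<close>[OF that] by simp_all
    have den: "elementary_on U (\<lambda>x. 2 * sqrt (f x * g x))"
      using that(1,2) prod(1) by (intro elementary_on_intros)
    show "elementary_on U (\<lambda>x. imbalance (f x) (g x))"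
      unfolding imbalance_def using that(1,2) den prod(2)
      by (intro elementary_on_divide elementary_on_diff)
    show "elementary_on U (\<lambda>x. spread (f x) (g x))"
      unfolding spread_def using that(1,2) den prod(2)
      by (intro elementary_on_divide elementary_on.add)
  qed
  let ?kappa = "\<lambda>x. kappa ((cmod (z1 x))\<^sup>2) ((cmod (z2 x))\<^sup>2) ((cmod (z3 x))\<^sup>2) ((cmod (z4 x))\<^sup>2)"
  have kappa: "elementary_on U ?kappa"
    unfolding kappa_def by (intro elementary_on_intros m)
  have kp: "?kappa x \<noteq> 0" "1 + ?kappa x > 0" if "x \<in> U" for x
    using kappa_pos[OF pos[OF that]] by simp_all
  have tilt: "elementary_on U (\<lambda>x. tilt ((cmod (z1 x))\<^sup>2) ((cmod (z2 x))\<^sup>2) ((cmod (z3 x))\<^sup>2)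
      ((cmod (z4 x))\<^sup>2))"
    unfolding tilt_def by (intro elementary_on_intros m kappa kp)
  note intros = elementary_on.const elementary_on.mult elementary_on_divide bin m pos tilt kappa kp h
  show ?thesis
    unfolding orbit_map_def vector_scaleR_component real_scaleR_def
    using exhaust_4[of i]
    by (elim disjE; simp only: invariants_nth; intro intros assms(2))
qed

theorem proposition1p4:
  shows
    "(\<forall>x\<in>S7. nu x = 4 * Im (z1 x * z2 x * z3 x * z4 x)) \<and>
     nu ` S7 = {-1/4..1/4} \<and>
     critical_values S7 nu - {0} = {-1/4, 1/4} \<and>
     diffeomorphic (critical_points S7 nu \<inter> level_set (1/4)) T3 \<and>
     diffeomorphic (critical_points S7 nu \<inter> level_set (-1/4)) T3 \<and>
     (\<exists>W E. topological_graph (orbit_space (critical_points S7 nu \<inter> level_set 0)) W E \<and>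
        card W = 4 \<and> card E = 6 \<and>
        (\<forall>v\<in>W. card {e \<in> E. v \<in> e} = 3) \<and>
        (\<forall>v\<in>W. \<forall>w\<in>W. v \<noteq> w \<longrightarrow> (\<exists>!e. e \<in> E \<and> e \<inter> W = {v, w}))) \<and>
     (\<forall>s \<in> {-1/4<..<0} \<union> {0<..<1/4}.
        regular_value S7 nu s \<and>
        (\<exists>A :: ((real^8) set set \<times> ((real^8) set \<Rightarrow> real^3)) set.
           quotient_manifold (level_set s) T3_orbit A \<and>
           manifold_diffeomorphic (orbit_space (level_set s)) A (sphere (0 :: real^4) 1)))"
proof (intro conjI ballI)
  show "nu x = 4 * Im (z1 x * z2 x * z3 x * z4 x)" for x by (rule nu_eq)
  show "nu ` S7 = {-1/4..1/4}" by (rule nu_image)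
  show "critical_values S7 nu - {0} = {-1/4, 1/4}" by (rule critical_values_nu)
  show "diffeomorphic (critical_points S7 nu \<inter> level_set (1/4)) T3"
    "diffeomorphic (critical_points S7 nu \<inter> level_set (-1/4)) T3"
    by (rule diffeomorphic_critical_level; simp)+
  show "\<exists>W E. topological_graph (orbit_space (critical_points S7 nu \<inter> level_set 0)) W E \<and>
        card W = 4 \<and> card E = 6 \<and>
        (\<forall>v\<in>W. card {e \<in> E. v \<in> e} = 3) \<and>
        (\<forall>v\<in>W. \<forall>w\<in>W. v \<noteq> w \<longrightarrow> (\<exists>!e. e \<in> E \<and> e \<inter> W = {v, w}))"
    by (rule critical_zero_graph)
next
  fix s :: real assume s: "s \<in> {-1/4<..<0} \<union> {0<..<1/4}"
  show "regular_value S7 nu s"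
    unfolding regular_value_def
  \<comment> \<open>A critical point off the zero level would have
    \<open>\<bar>nu p\<bar> = 1/4\<close>, outside the given range.\<close>
  proof (intro ballI impI, rule ccontr)
    fix p assume "p \<in> S7" "nu p = s" "differential_range S7 nu p \<noteq> UNIV"
    then have "p \<in> critical_points S7 nu" "nu p \<noteq> 0" using s by (auto simp: critical_points_def)
    then have "\<bar>nu p\<bar> = 1/4" by (rule critical_nonzero(6))
    then show False using \<open>nu p = s\<close> s by auto
  qed
  define \<sigma> where "\<sigma> = s / 4"
  have \<sigma>: "\<sigma> \<noteq> 0" "\<bar>\<sigma>\<bar> < 1/16" using s by (auto simp: \<sigma>_def)
  have s_eq: "s = 4 * \<sigma>" by (simp add: \<sigma>_def)
  show "\<exists>A :: ((real^8) set set \<times> ((real^8) set \<Rightarrow> real^3)) set.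
           quotient_manifold (level_set s) T3_orbit A \<and>
           manifold_diffeomorphic (orbit_space (level_set s)) A (sphere (0 :: real^4) 1)"
    unfolding s_eq
  \<comment> \<open>The open set \<open>W\<close> consists of the points without vanishing
    coordinate; it contains every non-zero level, and \<open>orbit_map \<sigma>\<close> is
    elementary there.\<close>
  proof (rule quotient_sphere[where W = "{x. z_prod x \<noteq> 0}" and \<Phi> = "orbit_map \<sigma>"])
    show "compact (level_set (4 * \<sigma>))" by (rule compact_level_set)
    show "open {x. z_prod x \<noteq> 0}"
      unfolding z_prod_def by (intro open_Collect_neq continuous_intros)
    show "level_set (4 * \<sigma>) \<subseteq> {x. z_prod x \<noteq> 0}" using \<sigma>(1) by (auto simp: level_set_iff)
    show "elementary_on {x. z_prod x \<noteq> 0} (\<lambda>x. orbit_map \<sigma> x $ i)" for i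
      by (rule elementary_on_orbit_map) (use \<sigma> in auto)
    show "orbit_map \<sigma> ` level_set (4 * \<sigma>) = sphere 0 1"
    proof (intro equalityI image_subsetI subsetI)
      show "orbit_map \<sigma> x \<in> sphere 0 1" if "x \<in> level_set (4 * \<sigma>)" for x
        by (rule orbit_map_in_sphere[OF that \<sigma>])
      show "y \<in> orbit_map \<sigma> ` level_set (4 * \<sigma>)" if "y \<in> sphere 0 1" for y
        using orbit_section[OF that \<sigma>] by (metis imageI)
    qed
    show "\<forall>x\<in>level_set (4 * \<sigma>). \<forall>y\<in>level_set (4 * \<sigma>).
        T3_orbit x = T3_orbit y \<longleftrightarrow> orbit_map \<sigma> x = orbit_map \<sigma> y"
      using T3_orbit_eq_iff_orbit_map[OF _ _ \<sigma>] by blast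
  qed (rule orbit_section_through[OF _ \<sigma>])
qed

end
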